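(* Let $U=(u_n)_{n\ge 0}$ be a Pisot numeration associated with a Pisot number $\beta$ of degree $d$, with standard initial conditions. If $U$ preserves zeros, then there is a continuous group epimorphism $\Phi:\mathbb{Z}_U\to\mathbb{T}^{d-1}$, where $\mathbb{T}^{d-1}=\mathbb{R}^{d-1}/\mathbb{Z}^{d-1}$; moreover, if $\beta$ is unimodular, then $\Phi$ is an isomorphism of topological groups.
   Context: A Pisot number is a real algebraic integer $\beta>1$ all of whose other Galois conjugates have modulus strictly less than $1$. It is unimodular if the constant term of its minimal polynomial is $\pm1$. Let $P(X)=X^d-a_{d-1}X^{d-1}-\cdots-a_1X-a_0\in\mathbb{Z}[X]$ be the minimal polynomial of $\beta$. A Pisot numeration of degree $d$ associated to $\beta$ is a sequence $U=(u_n)_{n\ge0}$ of strictly positive integers with $u_0=1$, given by integer initial conditions $u_0=1,u_{-1},\dots,u_{-d+1}$ and the recurrence $u_n=a_{d-1}u_{n-1}+\cdots+a_0u_{n-d}$ for all $n\ge1$. It has standard initial conditions if $u_{-1}=\cdots=u_{-d+1}=0$. Finite sequences of integers $g=g_k\cdots g_0\in\mathbb{Z}^*$ (with $g_0$ the least significant digit) are identified with sequences $(g_n)_{n\ge0}$ with $g_n=0$ for $n>k$; put $[g]_U=\sum_i g_iu_i$. For $n\in\mathbb{N}$, $(n)_U$ is the normalised (greedy) expansion of $n$: the lexicographically greatest finite sequence $(d_i)_{i\ge 0}$ of non-negative integers with $\sum_i d_iu_i=n$, characterised by $\sum_{i=0}^{\ell}d_iu_i<u_{\ell+1}$ for each $\ell\ge0$.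 For a sequence $g$, $\operatorname{ord}(g)=\inf\{n:g_n\ne0\}$ ($=\infty$ for the zero sequence) and $\|g\|_\infty=\sup_n|g_n|$. For $n\in\mathbb{Z}$, $\nu_U(n)=\operatorname{ord}((|n|)_U)$, and for a finite sequence $g$, $\nu_U(g)=\nu_U([g]_U)$. $U$ preserves zeros if for each natural number $c$ there is a constant $K_c$ such that $\nu_U(g)\ge\operatorname{ord}(g)-K_c$ for each finite sequence $g\in\mathbb{Z}^*$ with $\|g\|_\infty\le c$. $\mathbb{G}$ is the abelian group of bounded sequences $g=(g_n)_{n\ge0}$ of integers under component-wise addition; $g_{[0:n)}=g_{n-1}\cdots g_0$; $\mathbb{H}_U=\{g\in\mathbb{G}:\lim_{n\to\infty}\nu_U(g_{[0:n)})=\infty\}$, a subgroup of $\mathbb{G}$; and $\mathbb{Z}_U=\mathbb{G}/\mathbb{H}_U$. Topology: let $\gamma<1$ be the maximum of the moduli of the Galois conjugates of $\beta$ other than $\beta$. Give $\mathbb{G}$ the metric $d(g,g')=\sum_{n\ge0}|g_n-g'_n|\gamma^n$ and $\mathbb{Z}_U$ the quotient topology. *)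

theory Defs
  imports
    "HOL-Analysis.Analysis"
    "HOL-Computational_Algebra.Polynomial_Factorial"
    "HOL-Algebra.Product_Groups"
begin

section \<open>Pisot numbers\<close>

definition is_min_poly :: "real \<Rightarrow> int poly \<Rightarrow> bool" where
  "is_min_poly x p \<longleftrightarrow>
     lead_coeff p = 1 \<and> poly (map_poly of_int p) x = 0 \<and>
     (\<forall>q::rat poly. q \<noteq> 0 \<and> poly (map_poly of_rat q) x = 0 \<longrightarrow> degree p \<le> degree q)"

text \<open>
  Meaningful for algebraic integers only, where the minimal polynomial over the rationals
  has integer coefficients; see \<open>is_min_poly_min_poly\<close> below.
\<close>
definition min_poly :: "real \<Rightarrow> int poly" where
  "min_poly x = (THE p. is_min_poly x p)"

definition galois_conjugates :: "real \<Rightarrow> complex set" where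
  "galois_conjugates x = {z. poly (map_poly of_int (min_poly x)) z = 0}"

definition pisot_number :: "real \<Rightarrow> bool" where
  "pisot_number \<beta> \<longleftrightarrow>
     algebraic_int \<beta> \<and> 1 < \<beta> \<and> (\<forall>z \<in> galois_conjugates \<beta> - {of_real \<beta>}. cmod z < 1)"

definition unimodular :: "real \<Rightarrow> bool" where
  "unimodular \<beta> \<longleftrightarrow> \<bar>coeff (min_poly \<beta>) 0\<bar> = 1"

definition pisot_degree :: "real \<Rightarrow> nat" where
  "pisot_degree \<beta> = degree (min_poly \<beta>)"

text \<open>
  In degree 1 there are no further conjugates and the maximum is over the empty set;
  the value 1/2 is then a convention (any value strictly between 0 and 1 gives a metric below).
\<close>
definition conj_radius :: "real \<Rightarrow> real" where
  "conj_radius \<beta> =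
     (if galois_conjugates \<beta> - {of_real \<beta>} = {} then 1 / 2
      else Max (cmod ` (galois_conjugates \<beta> - {of_real \<beta>})))"

section \<open>Pisot numerations\<close>

text \<open>
  The sequence \<open>U\<close> is the part of \<open>v\<close> with nonnegative indices. The initial conditions are the
  values of \<open>v\<close> at \<open>0, -1, \<dots>, -d+1\<close>; the values at smaller indices are irrelevant.
  As the minimal polynomial is \<open>X^d - a_{d-1} X^{d-1} - \<dots> - a_0\<close>,
  the coefficient \<open>a_i\<close> is \<open>- coeff (min_poly \<beta>) i\<close>.
\<close>
definition pisot_numeration :: "real \<Rightarrow> (int \<Rightarrow> int) \<Rightarrow> (nat \<Rightarrow> int) \<Rightarrow> bool" where
  "pisot_numeration \<beta> v U \<longleftrightarrow>
     pisot_number \<beta> \<and>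
     (\<forall>n. U n = v (int n)) \<and>
     (\<forall>n. U n > 0) \<and>
     v 0 = 1 \<and>
     (\<forall>n\<ge>1. v n = (\<Sum>i<pisot_degree \<beta>.
                      - coeff (min_poly \<beta>) i * v (n - int (pisot_degree \<beta>) + int i)))"

definition standard_initial_conditions :: "real \<Rightarrow> (int \<Rightarrow> int) \<Rightarrow> bool" where
  "standard_initial_conditions \<beta> v \<longleftrightarrow> (\<forall>j\<in>{1..<pisot_degree \<beta>}. v (- int j) = 0)"

section \<open>Expansions and preservation of zeros\<close>

definition finite_seqs :: "(nat \<Rightarrow> int) set" where
  "finite_seqs = {g. finite {i. g i \<noteq> 0}}"

definition seq_value :: "(nat \<Rightarrow> int) \<Rightarrow> (nat \<Rightarrow> int) \<Rightarrow> int" where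
  "seq_value U g = (\<Sum>i | g i \<noteq> 0. g i * U i)"

definition expansions :: "(nat \<Rightarrow> int) \<Rightarrow> int \<Rightarrow> (nat \<Rightarrow> int) set" where
  "expansions U n = {g \<in> finite_seqs. (\<forall>i. g i \<ge> 0) \<and> seq_value U g = n}"

text \<open>Digits are compared starting from the most significant one.\<close>
definition lex_less :: "(nat \<Rightarrow> int) \<Rightarrow> (nat \<Rightarrow> int) \<Rightarrow> bool" where
  "lex_less g h \<longleftrightarrow> (\<exists>k. g k < h k \<and> (\<forall>j>k. g j = h j))"

definition greedy :: "(nat \<Rightarrow> int) \<Rightarrow> int \<Rightarrow> (nat \<Rightarrow> int)" where
  "greedy U n = (THE g. g \<in> expansions U n \<and> (\<forall>h\<in>expansions U n. h \<noteq> g \<longrightarrow> lex_less h g))"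

text \<open>The infimum of the empty set in \<^typ>\<open>enat\<close> is \<open>\<infinity>\<close>.\<close>
definition seq_ord :: "(nat \<Rightarrow> int) \<Rightarrow> enat" where
  "seq_ord g = (INF n\<in>{n. g n \<noteq> 0}. enat n)"

definition nu :: "(nat \<Rightarrow> int) \<Rightarrow> int \<Rightarrow> enat" where
  "nu U n = seq_ord (greedy U \<bar>n\<bar>)"

definition nu_seq :: "(nat \<Rightarrow> int) \<Rightarrow> (nat \<Rightarrow> int) \<Rightarrow> enat" where
  "nu_seq U g = nu U (seq_value U g)"

text \<open>
  The inequality \<open>nu_seq U g \<ge> seq_ord g - K\<close> is written additively, since subtraction on
  \<^typ>\<open>enat\<close> is truncated.
\<close>
definition preserves_zeros :: "(nat \<Rightarrow> int) \<Rightarrow> bool" where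
  "preserves_zeros U \<longleftrightarrow>
     (\<forall>c::nat. \<exists>K::nat. \<forall>g\<in>finite_seqs.
        (\<forall>n. \<bar>g n\<bar> \<le> int c) \<longrightarrow> seq_ord g \<le> nu_seq U g + enat K)"

section \<open>The topological group attached to a numeration\<close>

definition bounded_seq_group :: "(nat \<Rightarrow> int) monoid" where
  "bounded_seq_group =
     \<lparr>carrier = {g. bounded (range g)}, monoid.mult = (\<lambda>g h n. g n + h n), one = (\<lambda>_. 0)\<rparr>"

definition seq_prefix :: "nat \<Rightarrow> (nat \<Rightarrow> int) \<Rightarrow> (nat \<Rightarrow> int)" where
  "seq_prefix n g = (\<lambda>i. if i < n then g i else 0)"

definition null_seqs :: "(nat \<Rightarrow> int) \<Rightarrow> (nat \<Rightarrow> int) set" where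
  "null_seqs U = {g \<in> carrier bounded_seq_group. (\<lambda>n. nu_seq U (seq_prefix n g)) \<longlonglongrightarrow> \<infinity>}"

definition Z_group :: "(nat \<Rightarrow> int) \<Rightarrow> (nat \<Rightarrow> int) set monoid" where
  "Z_group U = bounded_seq_group Mod null_seqs U"

text \<open>The value 0 off the carrier only serves to satisfy the locale \<^locale>\<open>Metric_space\<close>.\<close>
definition seq_dist :: "real \<Rightarrow> (nat \<Rightarrow> int) \<Rightarrow> (nat \<Rightarrow> int) \<Rightarrow> real" where
  "seq_dist \<gamma> g h =
     (if g \<in> carrier bounded_seq_group \<and> h \<in> carrier bounded_seq_group
      then \<Sum>n. of_int \<bar>g n - h n\<bar> * \<gamma> ^ n else 0)"

definition seq_topology :: "real \<Rightarrow> (nat \<Rightarrow> int) topology" where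
  "seq_topology \<beta> =
     Metric_space.mtopology (carrier bounded_seq_group) (seq_dist (conj_radius \<beta>))"

text \<open>The final topology on the image of \<open>f\<close>; see \<open>quotient_map_quotient_topology\<close>.\<close>
definition quotient_topology :: "'a topology \<Rightarrow> ('a \<Rightarrow> 'b) \<Rightarrow> 'b topology" where
  "quotient_topology X f =
     topology (\<lambda>V. V \<subseteq> f ` topspace X \<and> openin X {x \<in> topspace X. f x \<in> V})"

definition Z_topology :: "real \<Rightarrow> (nat \<Rightarrow> int) \<Rightarrow> (nat \<Rightarrow> int) set topology" where
  "Z_topology \<beta> U =
     quotient_topology (seq_topology \<beta>) (\<lambda>g. null_seqs U #>\<^bsub>bounded_seq_group\<^esub> g)"

section \<open>Tori\<close>

definition real_add_group :: "real monoid" where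
  "real_add_group = \<lparr>carrier = UNIV, monoid.mult = (+), one = 0\<rparr>"

text \<open>
  Points of Euclidean \<open>m\<close>-space are the functions on \<open>{..<m}\<close> extended by \<open>undefined\<close>, so that
  \<open>m\<close> may be a term; for \<open>m = 0\<close> there is exactly one such function.
\<close>
definition real_space_group :: "nat \<Rightarrow> (nat \<Rightarrow> real) monoid" where
  "real_space_group m = product_group {..<m} (\<lambda>_. real_add_group)"

definition integer_lattice :: "nat \<Rightarrow> (nat \<Rightarrow> real) set" where
  "integer_lattice m = (\<Pi>\<^sub>E i\<in>{..<m}. \<int>)"

definition torus_group :: "nat \<Rightarrow> (nat \<Rightarrow> real) set monoid" where
  "torus_group m = real_space_group m Mod integer_lattice m"

definition torus_topology :: "nat \<Rightarrow> (nat \<Rightarrow> real) set topology" where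
  "torus_topology m =
     quotient_topology (product_topology (\<lambda>_. euclideanreal) {..<m})
       (\<lambda>x. integer_lattice m #>\<^bsub>real_space_group m\<^esub> x)"

section \<open>Consistency of the definitions\<close>

lemma is_min_poly_unique:
  assumes "is_min_poly x p" "is_min_poly x q"
  shows "p = q"
proof (rule ccontr)
  assume "p \<noteq> q"
  have zero: "poly (map_poly of_int p) x = 0" "poly (map_poly of_int q) x = 0"
    and lc: "lead_coeff p = 1" "lead_coeff q = 1"
    using assms by (auto simp: is_min_poly_def)
  have emb: "map_poly (of_rat :: rat \<Rightarrow> real) (map_poly of_int s) = map_poly of_int s" for s
    by (simp add: map_poly_map_poly o_def)
  have min: "degree p \<le> degree r" "degree q \<le> degree r"
    if "r \<noteq> 0" "poly (map_poly of_int r) x = 0" for r :: "int poly"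
  proof -
    let ?r = "map_poly of_int r :: rat poly"
    have "?r \<noteq> 0" "degree ?r = degree r"
      using that(1) by (auto simp: poly_eq_iff coeff_map_poly intro: degree_map_poly)
    then show "degree p \<le> degree r" "degree q \<le> degree r"
      using assms that(2) emb[of r] unfolding is_min_poly_def by metis+
  qed
  have nz: "p \<noteq> 0" "q \<noteq> 0" using lc by auto
  have deg: "degree p = degree q"
    using min(1)[OF nz(2) zero(2)] min(2)[OF nz(1) zero(1)] by simp
  have diff: "map_poly (of_int :: int \<Rightarrow> real) (p - q) = map_poly of_int p - map_poly of_int q"
    by (simp add: poly_eq_iff coeff_map_poly)
  have "degree p \<le> degree (p - q)"
    using \<open>p \<noteq> q\<close> zero diff by (intro min) auto
  moreover have "degree (p - q) \<le> degree p"
    using deg by (simp add: degree_diff_le)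
  ultimately have "coeff (p - q) (degree p) \<noteq> 0"
    using \<open>p \<noteq> q\<close> leading_coeff_0_iff[of "p - q"] by simp
  then show False using lc deg by simp
qed

lemma clear_denominators:
  fixes q :: "rat poly"
  obtains r :: "int poly" and c :: int where "c \<noteq> 0" "map_poly of_int r = smult (of_int c) q"
proof -
  define D where "D i = snd (quotient_of (coeff q i))" for i
  define N where "N i = fst (quotient_of (coeff q i))" for i
  define c where "c = (\<Prod>i\<le>degree q. D i)"
  have pos: "D i > 0" for i
    unfolding D_def by (rule quotient_of_denom_pos')
  have cf: "coeff q i = of_int (N i) / of_int (D i)" for i
    unfolding D_def N_def by (rule quotient_of_div) simp
  have "\<exists>k::int. of_int c * coeff q i = of_int k" for i
  proof (cases "i \<le> degree q")
    case True
    then have "D i dvd c" unfolding c_def by (intro dvd_prodI) auto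
    then obtain e where "c = D i * e" by auto
    then have "of_int c * coeff q i = of_int (N i * e)"
      using pos[of i] by (simp add: cf)
    then show ?thesis by blast
  next
    case False
    then have "of_int c * coeff q i = of_int 0" by (simp add: coeff_eq_0)
    then show ?thesis by blast
  qed
  then have "\<exists>k. \<forall>i. of_int c * coeff q i = of_int (k i)" by (intro choice) blast
  then obtain k :: "nat \<Rightarrow> int" where k: "\<And>i. of_int c * coeff q i = of_int (k i)" by blast
  define r where "r = Abs_poly k"
  have "k i = 0" if "i > degree q" for i
    using k[of i] that by (simp add: coeff_eq_0)
  then have "coeff r = k" unfolding r_def by (intro coeff_Abs_poly[of "degree q"]) auto
  then have "smult (of_int c) q = map_poly of_int r"
    by (simp add: poly_eq_iff coeff_map_poly k)
  moreover have "D i \<noteq> 0" for i using pos[of i] by simp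
  then have "c \<noteq> 0" by (simp add: c_def)
  ultimately show ?thesis using that by metis
qed

lemma is_min_poly_min_poly:
  assumes "algebraic_int x"
  shows "is_min_poly x (min_poly x)"
proof -
  let ?ev = "\<lambda>p::int poly. poly (map_poly of_int p) x"
  have ev_mult: "?ev (p * q) = ?ev p * ?ev q" and ev_smult: "?ev (smult c p) = of_int c * ?ev p"
    and ev_diff: "?ev (p - q) = ?ev p - ?ev q" for p q c
  proof -
    have "map_poly (of_int :: int \<Rightarrow> real) (p * q) = map_poly of_int p * map_poly of_int q"
      by (simp add: poly_eq_iff coeff_map_poly coeff_mult)
    then show "?ev (p * q) = ?ev p * ?ev q" by simp
    have "map_poly (of_int :: int \<Rightarrow> real) (smult c p) = smult (of_int c) (map_poly of_int p)"
      by (simp add: poly_eq_iff coeff_map_poly)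
    then show "?ev (smult c p) = of_int c * ?ev p" by simp
    have "map_poly (of_int :: int \<Rightarrow> real) (p - q) = map_poly of_int p - map_poly of_int q"
      by (simp add: poly_eq_iff coeff_map_poly)
    then show "?ev (p - q) = ?ev p - ?ev q" by simp
  qed
  obtain f where f: "lead_coeff f = 1" "?ev f = 0"
    using assms unfolding algebraic_int_altdef_ipoly by auto
  then have "\<exists>p. p \<noteq> 0 \<and> ?ev p = 0" by (intro exI[of _ f]) auto
  then obtain p0 where p0: "p0 \<noteq> 0" "?ev p0 = 0"
    and p0_min: "\<And>r. r \<noteq> 0 \<Longrightarrow> ?ev r = 0 \<Longrightarrow> degree p0 \<le> degree r"
    using ex_has_least_nat[of "\<lambda>p. p \<noteq> 0 \<and> ?ev p = 0" _ degree] by metis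
  define p where "p = primitive_part p0"
  have p: "p \<noteq> 0" "content p = 1" "degree p = degree p0"
    using p0(1) by (auto simp: p_def)
  have "p0 = smult (content p0) p" by (simp add: p_def)
  then have "?ev p = 0" using p0 ev_smult[of "content p0" p] by auto
  obtain s t where st: "pseudo_divmod f p = (s, t)" by (cases "pseudo_divmod f p")
  define c where "c = lead_coeff p ^ (Suc (degree f) - degree p)"
  have c0: "c \<noteq> 0" using p(1) by (simp add: c_def)
  have st': "smult c f = p * s + t" "t = 0 \<or> degree t < degree p"
    using pseudo_divmod[OF p(1) st] by (auto simp: c_def)
  have "?ev t = ?ev (smult c f - p * s)" using st'(1) by simp
  also have "\<dots> = 0" using f(2) \<open>?ev p = 0\<close> by (simp add: ev_diff ev_mult ev_smult)
  finally have "t = 0" using st'(2) p0_min[of t] p(3) by (metis leD)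
  then have eq: "smult c f = p * s" using st' by simp
  have "content s = content (p * s)" by (simp add: content_mult p)
  also have "\<dots> = normalize c * content f" unfolding eq[symmetric] by simp
  finally have "c dvd content s" by simp
  then have "[:c:] dvd s" by (simp add: const_poly_dvd_iff_dvd_content)
  then obtain s' where s': "s = smult c s'" by auto
  have "smult c f = smult c (p * s')" using eq s' by simp
  then have "f = p * s'" using c0 by (metis smult_cancel)
  then have "lead_coeff p * lead_coeff s' = 1" using f(1) by (simp add: lead_coeff_mult)
  then have "lead_coeff p dvd 1" by (intro dvdI) (rule sym)
  then have lc: "\<bar>lead_coeff p\<bar> = 1" by (simp only: zdvd1_eq)
  define m where "m = smult (lead_coeff p) p"
  have "is_min_poly x m"
    unfolding is_min_poly_def
  proof (intro conjI allI impI)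
    show "lead_coeff m = 1" using lc by (auto simp: m_def abs_if split: if_splits)
    show "?ev m = 0" using \<open>?ev p = 0\<close> by (simp add: m_def ev_smult)
    fix q :: "rat poly" assume q: "q \<noteq> 0 \<and> poly (map_poly of_rat q) x = 0"
    obtain r c where r: "(c::int) \<noteq> 0" "map_poly of_int r = smult (of_int c) q"
      by (rule clear_denominators)
    have "map_poly (of_int :: int \<Rightarrow> real) r = map_poly of_rat (map_poly of_int r)"
      by (simp add: map_poly_map_poly o_def)
    also have "\<dots> = smult (of_int c) (map_poly of_rat q)"
      unfolding r(2) by (simp add: poly_eq_iff coeff_map_poly of_rat_mult)
    finally have "?ev r = 0" using q by simp
    moreover have "r \<noteq> 0" using r q by auto
    ultimately have "degree p0 \<le> degree r" by (intro p0_min)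
    also have "degree r = degree (map_poly of_int r :: rat poly)"
      by (rule degree_map_poly[symmetric]) auto
    finally show "degree m \<le> degree q" using r p lc by (auto simp: m_def)
  qed
  then show ?thesis
    unfolding min_poly_def by (rule theI) (rule is_min_poly_unique[OF _ \<open>is_min_poly x m\<close>])
qed

lemma greedy_characterisation:
  assumes pos: "\<And>i. U i > 0" and U0: "U 0 = 1" and d: "d \<in> expansions U n"
  shows "(\<forall>e\<in>expansions U n. e \<noteq> d \<longrightarrow> lex_less e d) \<longleftrightarrow>
         (\<forall>l. (\<Sum>i\<le>l. d i * U i) < U (Suc l))"
proof -
  have val: "seq_value U g = (\<Sum>i\<le>k. g i * U i)" if "\<And>i. i > k \<Longrightarrow> g i = 0" for g k
    unfolding seq_value_def using that by (intro sum.mono_neutral_left) (auto intro: leI)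
  have bound: "\<exists>k. \<forall>i>k. g i = 0" if "g \<in> finite_seqs" for g
    using that unfolding finite_seqs_def
    by (metis (mono_tags, lifting) finite_nat_iff_bounded_le mem_Collect_eq atMost_iff subsetD not_le)
  have asym: False if gh: "lex_less g h" and hg: "lex_less h g" for g h
  proof -
    obtain k where k: "g k < h k" "\<forall>j>k. g j = h j" using gh by (auto simp: lex_less_def)
    obtain l where l: "h l < g l" "\<forall>j>l. h j = g j" using hg by (auto simp: lex_less_def)
    show False using k l by (metis less_irrefl linorder_neqE_nat less_asym)
  qed
  show ?thesis
  proof
    assume greedy: "\<forall>e\<in>expansions U n. e \<noteq> d \<longrightarrow> lex_less e d"
    show "\<forall>l. (\<Sum>i\<le>l. d i * U i) < U (Suc l)"
    proof (rule ccontr)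
      assume "\<not> (\<forall>l. (\<Sum>i\<le>l. d i * U i) < U (Suc l))"
      then obtain l where l: "U (Suc l) \<le> (\<Sum>i\<le>l. d i * U i)" by (auto simp: not_less)
      define e where "e i = (if i = 0 then (\<Sum>i\<le>l. d i * U i) - U (Suc l)
        else if i \<le> l then 0 else if i = Suc l then d i + 1 else d i)" for i
      obtain k where k: "\<forall>i>k. d i = 0" using d bound[of d] unfolding expansions_def by blast
      define m where "m = max k (Suc l)"
      have e0: "e i = 0" and d0: "d i = 0" if "i > m" for i
        using that k by (auto simp: e_def m_def)
      have split: "(\<Sum>i\<le>m. g i) = (\<Sum>i\<le>l. g i) + g (Suc l) + (\<Sum>i\<in>{Suc l<..m}. g i)"
        for g :: "nat \<Rightarrow> int"
      proof -
        have "{..m} = {..l} \<union> {Suc l} \<union> {Suc l<..m}" by (auto simp: m_def)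
        then show ?thesis by (simp only:) (subst sum.union_disjoint; auto)+
      qed
      have "(\<Sum>i\<le>l. e i * U i) = (\<Sum>i\<in>{0}. e i * U i)"
        by (intro sum.mono_neutral_right) (auto simp: e_def)
      then have "(\<Sum>i\<le>l. e i * U i) = (\<Sum>i\<le>l. d i * U i) - U (Suc l)"
        by (simp add: e_def U0)
      moreover have "(\<Sum>i\<in>{Suc l<..m}. e i * U i) = (\<Sum>i\<in>{Suc l<..m}. d i * U i)"
        by (intro sum.cong) (auto simp: e_def)
      moreover have "e (Suc l) * U (Suc l) = d (Suc l) * U (Suc l) + U (Suc l)"
        by (simp add: e_def algebra_simps)
      ultimately have "(\<Sum>i\<le>m. e i * U i) = (\<Sum>i\<le>m. d i * U i)"
        unfolding split by simp
      then have "seq_value U e = n"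
        using val[of m e] val[of m d] e0 d0 d by (auto simp: expansions_def)
      moreover have "e \<in> finite_seqs"
        unfolding finite_seqs_def
        using e0 by (auto intro!: finite_subset[of _ "{..m}"]) (meson not_le)
      moreover have "\<forall>i. e i \<ge> 0" using l d by (auto simp: e_def expansions_def)
      ultimately have "e \<in> expansions U n" by (simp add: expansions_def)
      moreover have "lex_less d e"
        unfolding lex_less_def by (rule exI[of _ "Suc l"]) (auto simp: e_def)
      moreover have "e \<noteq> d" by (metis \<open>lex_less d e\<close> asym)
      ultimately show False using greedy asym by blast
    qed
  next
    assume bd: "\<forall>l. (\<Sum>i\<le>l. d i * U i) < U (Suc l)"
    show "\<forall>e\<in>expansions U n. e \<noteq> d \<longrightarrow> lex_less e d"
    proof (intro ballI impI)
      fix e assume e: "e \<in> expansions U n" "e \<noteq> d"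
      obtain k1 where k1: "\<forall>i>k1. d i = 0" using d bound[of d] unfolding expansions_def by blast
      obtain k2 where k2: "\<forall>i>k2. e i = 0" using e bound[of e] unfolding expansions_def by blast
      define D where "D = {i. e i \<noteq> d i}"
      have fin: "finite D" unfolding D_def
      proof (rule finite_subset)
        show "{i. e i \<noteq> d i} \<subseteq> {..max k1 k2}"
        proof (intro subsetI, rule ccontr)
          fix i assume "i \<in> {i. e i \<noteq> d i}" "i \<notin> {..max k1 k2}"
          then show False using k1 k2 by simp
        qed
      qed simp
      have ne: "D \<noteq> {}" using e(2) by (auto simp: D_def)
      define k where "k = Max D"
      have k: "e k \<noteq> d k" using Max_in[OF fin ne] by (auto simp: k_def D_def)
      have above: "e j = d j" if "j > k" for j
        using Max_ge[OF fin, of j] that by (auto simp: k_def D_def)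
      define m where "m = max k (max k1 k2)"
      have "(\<Sum>i\<le>m. e i * U i) = (\<Sum>i\<le>m. d i * U i)"
        using val[of m e] val[of m d] k1 k2 e(1) d by (auto simp: expansions_def m_def)
      moreover have "(\<Sum>i\<le>m. g i) = (\<Sum>i\<le>k. g i) + (\<Sum>i\<in>{k<..m}. g i)" for g :: "nat \<Rightarrow> int"
      proof -
        have "{..m} = {..k} \<union> {k<..m}" by (auto simp: m_def)
        then show ?thesis by (simp only:) (subst sum.union_disjoint; auto)
      qed
      moreover have "(\<Sum>i\<in>{k<..m}. e i * U i) = (\<Sum>i\<in>{k<..m}. d i * U i)"
        by (intro sum.cong) (auto simp: above)
      ultimately have eq: "(\<Sum>i\<le>k. e i * U i) = (\<Sum>i\<le>k. d i * U i)" by simp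
      have split: "(\<Sum>i\<le>k. g i) = (\<Sum>i<k. g i) + g k" for g :: "nat \<Rightarrow> int"
        by (simp add: lessThan_Suc_atMost[symmetric])
      have "(\<Sum>i<k. d i * U i) < U k"
      proof (cases k)
        case 0
        then show ?thesis using pos by simp
      next
        case (Suc l)
        then show ?thesis using bd by (simp add: lessThan_Suc_atMost)
      qed
      moreover have "(\<Sum>i<k. e i * U i) \<ge> 0"
        using e(1) pos by (intro sum_nonneg) (auto simp: expansions_def less_imp_le)
      ultimately have "e k * U k < (d k + 1) * U k"
        using eq unfolding split by (simp add: algebra_simps)
      then have "e k < d k" using k pos[of k] by (simp add: mult_less_cancel_right)
      then show "lex_less e d" using above unfolding lex_less_def by blast
    qed
  qed
qed

lemma Metric_space_seq_dist:
  assumes "0 < \<gamma>" "\<gamma> < 1"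
  shows "Metric_space (carrier bounded_seq_group) (seq_dist \<gamma>)"
proof
  let ?t = "\<lambda>g h n. of_int \<bar>g n - h n\<bar> * \<gamma> ^ n :: real"
  have nonneg: "?t g h n \<ge> 0" for g h n using assms by simp
  have summable: "summable (?t g h)"
    if gh: "g \<in> carrier bounded_seq_group" "h \<in> carrier bounded_seq_group" for g h
  proof -
    obtain B where B: "\<And>n. of_int \<bar>g n\<bar> \<le> (B :: real)"
      using gh(1) by (auto simp: bounded_seq_group_def bounded_iff)
    obtain C where C: "\<And>n. of_int \<bar>h n\<bar> \<le> (C :: real)"
      using gh(2) by (auto simp: bounded_seq_group_def bounded_iff)
    have "norm (?t g h n) \<le> (B + C) * \<gamma> ^ n" for n
    proof -
      have "of_int \<bar>g n - h n\<bar> \<le> B + C" using B[of n] C[of n] by linarith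
      then show ?thesis using assms by (simp add: abs_mult mult_right_mono)
    qed
    moreover have "summable (\<lambda>n. (B + C) * \<gamma> ^ n)"
      using assms by (intro summable_mult summable_geometric) simp
    ultimately show ?thesis by (blast intro: summable_comparison_test')
  qed
  fix g h k
  show "0 \<le> seq_dist \<gamma> g h"
    unfolding seq_dist_def using nonneg summable by (auto intro: suminf_nonneg)
  show "seq_dist \<gamma> g h = seq_dist \<gamma> h g"
    by (simp add: seq_dist_def abs_minus_commute conj_commute)
  assume g: "g \<in> carrier bounded_seq_group" and h: "h \<in> carrier bounded_seq_group"
  show "seq_dist \<gamma> g h = 0 \<longleftrightarrow> g = h"
    using suminf_eq_zero_iff[OF summable[OF g h] nonneg[where g = g and h = h]] assms g h
    by (simp add: seq_dist_def fun_eq_iff)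
  assume k: "k \<in> carrier bounded_seq_group"
  have "?t g k n \<le> ?t g h n + ?t h k n" for n
  proof -
    have "of_int \<bar>g n - k n\<bar> \<le> (of_int \<bar>g n - h n\<bar> + of_int \<bar>h n - k n\<bar> :: real)" by linarith
    then show ?thesis using assms by (simp add: mult_right_mono flip: distrib_right)
  qed
  then show "seq_dist \<gamma> g k \<le> seq_dist \<gamma> g h + seq_dist \<gamma> h k"
    unfolding seq_dist_def
    using suminf_le[of "?t g k" "\<lambda>n. ?t g h n + ?t h k n", OF _ summable[OF g k] summable_add[OF summable[OF g h] summable[OF h k]]]
      suminf_add[OF summable[OF g h] summable[OF h k]] g h k by simp
qed

lemma openin_quotient_topology:
  "openin (quotient_topology X f) V \<longleftrightarrow>
     V \<subseteq> f ` topspace X \<and> openin X {x \<in> topspace X. f x \<in> V}"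
proof -
  have "istopology (\<lambda>V. V \<subseteq> f ` topspace X \<and> openin X {x \<in> topspace X. f x \<in> V})"
    unfolding istopology_def
  proof (intro conjI allI impI)
    fix S T
    assume "S \<subseteq> f ` topspace X \<and> openin X {x \<in> topspace X. f x \<in> S}"
      and "T \<subseteq> f ` topspace X \<and> openin X {x \<in> topspace X. f x \<in> T}"
    then show "S \<inter> T \<subseteq> f ` topspace X" "openin X {x \<in> topspace X. f x \<in> S \<inter> T}"
      using openin_Int[of X "{x \<in> topspace X. f x \<in> S}" "{x \<in> topspace X. f x \<in> T}"]
      by (auto simp: Int_def conj_ac cong: conj_cong)
  next
    fix K
    assume K: "\<forall>S\<in>K. S \<subseteq> f ` topspace X \<and> openin X {x \<in> topspace X. f x \<in> S}"
    then show "\<Union>K \<subseteq> f ` topspace X" by blast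
    have "{x \<in> topspace X. f x \<in> \<Union>K} = \<Union>((\<lambda>S. {x \<in> topspace X. f x \<in> S}) ` K)" by blast
    also have "openin X \<dots>" using K by (intro openin_Union) auto
    finally show "openin X {x \<in> topspace X. f x \<in> \<Union>K}" .
  qed
  then show ?thesis by (simp add: quotient_topology_def topology_inverse')
qed

lemma topspace_quotient_topology: "topspace (quotient_topology X f) = f ` topspace X"
proof
  show "topspace (quotient_topology X f) \<subseteq> f ` topspace X"
    using openin_topspace[of "quotient_topology X f"] unfolding openin_quotient_topology by blast
  have "{x \<in> topspace X. f x \<in> f ` topspace X} = topspace X" by auto
  then have "openin (quotient_topology X f) (f ` topspace X)"
    by (simp add: openin_quotient_topology)
  then show "f ` topspace X \<subseteq> topspace (quotient_topology X f)" by (rule openin_subset)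
qed

lemma quotient_map_quotient_topology: "quotient_map X (quotient_topology X f) f"
  by (auto simp: quotient_map_def topspace_quotient_topology openin_quotient_topology)

end

theory Submission
  imports Defs
    "HOL-Computational_Algebra.Fundamental_Theorem_Algebra"
    "HOL-Computational_Algebra.Field_as_Ring"
begin

text \<open>
Distinct conjugates and the standard initial conditions give \<open>u\<^sub>n = c \<beta>\<^sup>n + O(\<gamma>\<^sup>n)\<close> (up to the shift that
absorbs the negative indices), where \<open>\<gamma> < 1\<close> is exactly the largest modulus of a conjugate other than
\<open>\<beta>\<close> (if there is one). So \<open>\<beta>\<^sup>k u\<^sub>i\<close> differs from the integer \<open>u\<^bsub>i+k\<^esub>\<close> by \<open>O(\<gamma>\<^sup>i)\<close>, and for a bounded sequence \<open>g\<close> the series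
\<open>\<phi>\<^sub>k(g) = \<Sum> g\<^sub>i (\<beta>\<^sup>k u\<^sub>i - u\<^bsub>i+k\<^esub>)\<close> converges. It is additive in \<open>g\<close>, Lipschitz for the metric of the sequence
group, and on finite sequences it is congruent to \<open>[g]\<^sub>U \<beta>\<^sup>k\<close> modulo 1. The map \<open>\<Phi>\<close> is induced by
\<open>g \<mapsto> (\<phi>\<^sub>1(g), \<dots>, \<phi>\<^bsub>d-1\<^esub>(g))\<close> modulo integers.

\<^item> It is well defined (\<open>\<phi>_null_seqs\<close>): for a null sequence, the values of the prefixes have bounded
  expansions that begin arbitrarily late, so \<open>\<phi>\<^sub>k\<close> of the prefixes is an integer up to an error that
  tends to 0, and the limit \<open>\<phi>\<^sub>k(g)\<close> is an integer.

\<^item> It is onto (\<open>\<phi>_vec_dense\<close>, \<open>compact_onto_torus\<close>): the numbers \<open>1, \<beta>, \<dots>, \<beta>\<^bsup>d-1\<^esup>\<close> are linearly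
  independent over the rationals, so by Kronecker's theorem the multiples \<open>N (\<beta>, \<dots>, \<beta>\<^bsup>d-1\<^esup>)\<close> are dense
  modulo the lattice. All of them come from expansions with digits of modulus at most \<open>B\<close>, for one
  \<open>B\<close>, and the sequences with such digits form a compact set, whose image in the torus is closed. The same
  compactness shows that the torus carries the quotient topology (\<open>quotient_map_onto_torus\<close>), so
  that injectivity of \<open>\<Phi>\<close> is all that is left for a homeomorphism.

\<^item> It is injective if \<open>\<beta>\<close> is unimodular (\<open>unimodular_null_seqs\<close>). Suppose all \<open>\<phi>\<^sub>k(g)\<close> are integers.
  As the recurrence can be run backwards over the integers, subtracting from \<open>g\<close> a suitable sequence
  with \<open>d\<close> digits and value 0 makes all \<open>\<phi>\<^sub>k(g)\<close> vanish. This annihilates every contracting component of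
  \<open>g\<close>, so the sequence \<open>\<Sum>\<^bsub>i<n\<^esub> g\<^sub>i u\<^bsub>i+k\<^esub>\<close> in \<open>k\<close>, continued backwards by about \<open>n\<close> steps, arrives
  at values that are bounded independently of \<open>n\<close>. Hence the value of the prefix of length \<open>n\<close> is also \<open>\<Sum>\<^bsub>i<d\<^esub> h\<^sub>i u\<^bsub>n+i\<^esub>\<close> with integers \<open>h\<^sub>i\<close> that are bounded
  independently of \<open>n\<close>, and preservation of zeros makes its normalised expansion begin late.

Preservation of zeros is used in this last step and to see that the null sequences form a subgroup.
\<close>

section \<open>Minimal polynomials and their recurrences\<close>

lemma poly_map_of_rat_mult: "poly (map_poly of_rat (p * q)) (x::'a::field_char_0) = poly (map_poly of_rat p) x * poly (map_poly of_rat q) x"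
proof -
  have "map_poly (of_rat :: rat \<Rightarrow> 'a) (p * q) = map_poly of_rat p * map_poly of_rat q"
    by (simp add: poly_eq_iff coeff_map_poly coeff_mult of_rat_sum of_rat_mult)
  then show ?thesis by simp
qed

lemma map_of_rat_of_int: "map_poly (of_rat :: rat \<Rightarrow> 'a::field_char_0) (map_poly of_int p) = map_poly of_int p"
  by (simp add: map_poly_map_poly o_def)

text \<open>
A nonconstant common factor of the polynomial and its derivative would split it over the rationals
into factors of smaller degree, one of which still vanishes at \<open>x\<close>. So a Bezout identity over the
rationals excludes common complex roots.
\<close>
lemma rsquarefree_min_poly:
  assumes p: "is_min_poly x p"
  shows "rsquarefree (map_poly of_int p :: complex poly)"
proof -
  define P where "P = (map_poly of_int p :: rat poly)"
  have root: "poly (map_poly of_rat P) x = 0"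
    and min: "\<And>q. q \<noteq> 0 \<Longrightarrow> poly (map_poly of_rat q) x = 0 \<Longrightarrow> degree P \<le> degree q"
    using p by (auto simp: is_min_poly_def P_def map_of_rat_of_int degree_map_poly)
  have "lead_coeff P = 1" using p by (simp add: is_min_poly_def P_def degree_map_poly coeff_map_poly)
  then have "P \<noteq> 0" by auto
  have deg: "degree P > 0"
  proof (rule ccontr)
    assume "\<not> degree P > 0"
    then obtain k where "P = [:k:]" using degree_eq_zeroE by blast
    then show False using root \<open>P \<noteq> 0\<close> by (simp add: map_poly_pCons)
  qed
  \<comment> \<open>At \<open>x\<close> the cofactor \<open>S\<close> of the gcd vanishes instead of the gcd, so minimality makes the gcd constant.\<close>
  define D where "D = gcd P (pderiv P)"
  obtain S where S: "P = D * S" by (metis D_def dvdE gcd_dvd1)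
  have "S \<noteq> 0" "D \<noteq> 0" using S \<open>P \<noteq> 0\<close> by auto
  have "pderiv P \<noteq> 0" using deg by (simp add: pderiv_eq_0_iff)
  then have "degree D \<le> degree (pderiv P)" unfolding D_def by (intro dvd_imp_degree_le) auto
  then have "degree D < degree P" using deg by (simp add: degree_pderiv)
  then have "poly (map_poly of_rat D) x \<noteq> 0" using min[of D] \<open>D \<noteq> 0\<close> by auto
  then have "poly (map_poly of_rat S) x = 0" using root S by (simp add: poly_map_of_rat_mult)
  then have "degree P \<le> degree S" using min \<open>S \<noteq> 0\<close> by blast
  then have "degree D = 0" using S \<open>S \<noteq> 0\<close> \<open>D \<noteq> 0\<close> by (simp add: degree_mult_eq)
  then obtain k where k: "D = [:k:]" using degree_eq_zeroE by blast
  then have "k \<noteq> 0" using \<open>D \<noteq> 0\<close> by auto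
  define A B where "A = fst (bezout_coefficients P (pderiv P))" and "B = snd (bezout_coefficients P (pderiv P))"
  have bez: "A * P + B * pderiv P = D"
    unfolding A_def B_def D_def by (rule bezout_coefficients_fst_snd)
  have der: "map_poly (of_rat :: rat \<Rightarrow> complex) (pderiv P) = pderiv (map_poly of_int p)"
    by (simp add: poly_eq_iff coeff_map_poly coeff_pderiv P_def of_rat_mult of_rat_add)
  have "\<not> (poly (map_poly of_int p) z = 0 \<and> poly (pderiv (map_poly of_int p)) z = 0)" for z :: complex
  proof
    assume z: "poly (map_poly of_int p) z = 0 \<and> poly (pderiv (map_poly of_int p)) z = 0"
    have add: "map_poly (of_rat :: rat \<Rightarrow> complex) (f + g) = map_poly of_rat f + map_poly of_rat g" for f g
      by (simp add: poly_eq_iff coeff_map_poly of_rat_add)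
    have "poly (map_poly of_rat (A * P + B * pderiv P)) z = 0"
      using z by (simp add: add poly_map_of_rat_mult der) (simp add: P_def map_of_rat_of_int)
    then show False unfolding bez k using \<open>k \<noteq> 0\<close> by (simp add: map_poly_pCons)
  qed
  then show ?thesis by (simp add: rsquarefree_roots)
qed

text \<open>
Compare leading coefficients in the Lagrange interpolation of \<open>X\<^sup>m\<close> at the roots of \<open>p\<close>. As a sequence
in \<open>m\<close>, the left-hand side satisfies the recurrence of \<open>p\<close>, and the lemma says that its first values are
those of the impulse response \<open>0, \<dots>, 0, 1\<close>.
\<close>
lemma sum_power_over_pderiv:
  fixes p :: "complex poly"
  assumes sf: "rsquarefree p" and monic: "lead_coeff p = 1" and m: "m < degree p"
  shows "(\<Sum>z | poly p z = 0. z ^ m / poly (pderiv p) z) = (if m = degree p - 1 then 1 else 0)"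
proof -
  have [simp]: "p \<noteq> 0" using sf by (simp add: rsquarefree_def)
  define R where "R = {z. poly p z = 0}"
  have fin: "finite R" unfolding R_def by (simp add: poly_roots_finite)
  have "card R = degree p" 
  proof -
    have "p = (\<Prod>z\<in>R. [:-z, 1:])"
      using complex_poly_decompose_rsquarefree[OF sf] monic by (simp add: R_def)
    then have "degree p = degree (\<Prod>z\<in>R. [:-z, 1:])" by simp
    also have "\<dots> = (\<Sum>z\<in>R. degree [:-z, 1:])" by (rule degree_prod_eq_sum_degree) auto
    finally show ?thesis by simp
  qed
  define q where "q z = p div [:-z, 1:]" for z
  have q: "p = [:-z, 1:] * q z" if "z \<in> R" for z
    using that unfolding R_def q_def by (metis dvd_mult_div_cancel mem_Collect_eq poly_eq_0_iff_dvd)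
  have qz: "poly (q z) z = poly (pderiv p) z" if "z \<in> R" for z
  proof -
    have "pderiv p = pderiv ([:-z, 1:] * q z)" using q[OF that] by simp
    then show ?thesis by (simp only: pderiv_mult) (simp add: pderiv_pCons)
  qed
  have q0: "poly (q z) y = 0" if "z \<in> R" "y \<in> R" "y \<noteq> z" for z y
  proof -
    have "poly p y = (y - z) * poly (q z) y" by (subst q[OF that(1)]) (simp add: algebra_simps)
    then show ?thesis using that by (simp add: R_def)
  qed
  have der: "poly (pderiv p) z \<noteq> 0" if "z \<in> R" for z
    using sf that by (auto simp: rsquarefree_roots R_def)
  have dq: "degree (q z) = degree p - 1" and lq: "lead_coeff (q z) = 1" if "z \<in> R" for z
  proof -
    have "q z \<noteq> 0" using q[OF that] by auto
    then have "degree p = 1 + degree (q z)" by (subst q[OF that]) (subst degree_mult_eq; simp)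
    then show "degree (q z) = degree p - 1" by simp
    have "lead_coeff ([:-z, 1:] * q z) = lead_coeff (q z)" unfolding lead_coeff_mult by simp
    then have "lead_coeff p = lead_coeff (q z)" using q[OF that] by metis
    then show "lead_coeff (q z) = 1" using monic by simp
  qed
  define L where "L = (\<Sum>z\<in>R. smult (z ^ m / poly (pderiv p) z) (q z))"
  have "L = monom 1 m"
  proof (rule poly_eqI_degree)
    fix y assume y: "y \<in> R"
    have "poly L y = (\<Sum>z\<in>R. z ^ m / poly (pderiv p) z * poly (q z) y)"
      by (simp add: L_def poly_sum)
    also have "\<dots> = (\<Sum>z\<in>{y}. z ^ m / poly (pderiv p) z * poly (q z) y)"
      using y fin q0 by (intro sum.mono_neutral_right) auto
    finally show "poly L y = poly (monom 1 m) y" using y qz der by (simp add: poly_monom)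
  next
    have "degree L \<le> degree p - 1"
      unfolding L_def using fin dq by (intro degree_sum_le) (auto simp: degree_smult_le)
    then show "degree L < card R" using m \<open>card R = degree p\<close> by simp
    show "degree (monom 1 m :: complex poly) < card R" using m \<open>card R = degree p\<close> by (simp add: degree_monom_eq)
  qed
  then have "coeff L (degree p - 1) = (if m = degree p - 1 then 1 else 0)" by simp
  moreover have "coeff L (degree p - 1) = (\<Sum>z\<in>R. z ^ m / poly (pderiv p) z)"
    unfolding L_def coeff_sum
  proof (rule sum.cong)
    fix z assume z: "z \<in> R"
    have "coeff (q z) (degree p - 1) = 1" using dq[OF z] lq[OF z] by simp
    then show "coeff (smult (z ^ m / poly (pderiv p) z) (q z)) (degree p - 1) = z ^ m / poly (pderiv p) z"
      by simp
  qed simp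
  ultimately show ?thesis by (simp add: R_def)
qed

lemma degree_min_poly_pos:
  assumes "is_min_poly x p"
  shows "degree p > 0"
proof (rule ccontr)
  assume "\<not> degree p > 0"
  then obtain k where "p = [:k:]" using degree_eq_zeroE by blast
  then show False using assms by (auto simp: is_min_poly_def map_poly_pCons)
qed

lemma powers_independent:
  fixes q :: "nat \<Rightarrow> int"
  assumes p: "is_min_poly x p" and z: "(\<Sum>i<degree p. of_int (q i) * x ^ i) = 0" and i: "i < degree p"
  shows "q i = 0"
proof -
  define Q where "Q = (\<Sum>i<degree p. monom (of_int (q i) :: rat) i)"
  have co: "coeff Q j = (if j < degree p then of_int (q j) else 0)" for j
    by (simp add: Q_def coeff_sum)
  have "map_poly (of_rat :: rat \<Rightarrow> real) Q = (\<Sum>i<degree p. monom (of_int (q i)) i)"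
    by (simp add: poly_eq_iff coeff_map_poly co coeff_sum)
  then have "poly (map_poly of_rat Q) x = 0" using z by (simp add: poly_sum poly_monom)
  moreover have "degree Q < degree p"
    using i by (intro degree_lessI) (auto simp: co)
  ultimately have "Q = 0" using p by (auto simp: is_min_poly_def not_le[symmetric])
  then have "coeff Q i = 0" by simp
  then show ?thesis using i by (simp add: co)
qed

lemma min_poly_const_nonzero:
  assumes p: "is_min_poly x p" and "x \<noteq> 0"
  shows "coeff p 0 \<noteq> 0"
proof
  assume "coeff p 0 = 0"
  then obtain q where q: "p = pCons 0 q" by (metis pCons_cases coeff_pCons_0)
  have deg: "degree p > 0" by (rule degree_min_poly_pos[OF p])
  have "q \<noteq> 0" using q deg by auto
  then have dq: "degree p = Suc (degree q)" using q by (simp add: degree_pCons_eq)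
  have "poly (map_poly of_int p) x = x * poly (map_poly of_int q) x"
    unfolding q by (simp add: map_poly_pCons)
  then have "poly (map_poly of_int q) x = 0" using p \<open>x \<noteq> 0\<close> by (simp add: is_min_poly_def)
  then have "(\<Sum>i<degree p. of_int (coeff q i) * x ^ i) = 0"
    by (simp add: dq lessThan_Suc_atMost poly_altdef degree_map_poly coeff_map_poly)
  then have "coeff q (degree q) = 0" by (rule powers_independent[OF p]) (simp add: dq)
  then show False using \<open>q \<noteq> 0\<close> by auto
qed

lemma is_min_poly_root_powers:
  assumes p: "is_min_poly x p"
  shows "x ^ degree p = (\<Sum>i<degree p. of_int (- coeff p i) * x ^ i)"
proof -
  have "0 = (\<Sum>i\<le>degree p. of_int (coeff p i) * x ^ i)"
    using p by (simp add: is_min_poly_def poly_altdef degree_map_poly coeff_map_poly)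
  also have "\<dots> = (\<Sum>i<degree p. of_int (coeff p i) * x ^ i) + x ^ degree p"
    using p by (simp add: is_min_poly_def flip: lessThan_Suc_atMost)
  finally show ?thesis by (simp add: sum_negf)
qed

lemma conj_radius_bounds:
  assumes "pisot_number \<beta>"
  shows "0 < conj_radius \<beta>" "conj_radius \<beta> < 1"
    "\<And>z. z \<in> galois_conjugates \<beta> \<Longrightarrow> z \<noteq> of_real \<beta> \<Longrightarrow> cmod z \<le> conj_radius \<beta>"
proof -
  define S where "S = galois_conjugates \<beta> - {of_real \<beta>}"
  have b: "algebraic_int \<beta>" "1 < \<beta>" "\<forall>z\<in>S. cmod z < 1"
    using assms by (auto simp: pisot_number_def S_def)
  note mp = is_min_poly_min_poly[OF b(1)]
  have "map_poly of_int (min_poly \<beta>) \<noteq> (0 :: complex poly)"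
    using rsquarefree_min_poly[OF mp] by (simp add: rsquarefree_def)
  then have fin: "finite S"
    by (simp add: S_def galois_conjugates_def poly_roots_finite)
  have "0 \<notin> S"
  proof
    assume "0 \<in> S"
    then have "coeff (min_poly \<beta>) 0 = 0"
      by (simp add: S_def galois_conjugates_def poly_0_coeff_0 coeff_map_poly)
    then show False using min_poly_const_nonzero[OF mp] b by simp
  qed
  have r: "conj_radius \<beta> = (if S = {} then 1 / 2 else Max (cmod ` S))"
    by (simp add: conj_radius_def S_def)
  show le: "cmod z \<le> conj_radius \<beta>" if "z \<in> galois_conjugates \<beta>" "z \<noteq> of_real \<beta>" for z
  proof -
    have "z \<in> S" using that by (simp add: S_def)
    then show ?thesis using fin by (auto simp: r)
  qed
  show "conj_radius \<beta> < 1" using b fin by (auto simp: r)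
  show "0 < conj_radius \<beta>"
  proof (cases "S = {}")
    case False
    then obtain z where z: "z \<in> S" by auto
    then have "0 < cmod z" using \<open>0 \<notin> S\<close> by auto
    also have "cmod z \<le> conj_radius \<beta>" using z by (intro le) (auto simp: S_def)
    finally show ?thesis .
  qed (simp add: r)
qed

lemma linear_recurrence_unique:
  fixes x y :: "nat \<Rightarrow> 'a::comm_semiring_0"
  assumes "\<And>m. x (m + d) = (\<Sum>i<d. a i * x (m + i))"
    and "\<And>m. y (m + d) = (\<Sum>i<d. a i * y (m + i))"
    and "\<And>m. m < d \<Longrightarrow> x m = y m"
  shows "x m = y m"
proof (induction m rule: less_induct)
  case (less m)
  show ?case
  proof (cases "m < d")
    case False
    then obtain l where l: "m = l + d" by (metis add.commute le_add_diff_inverse not_less)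
    have "x (l + i) = y (l + i)" if "i < d" for i using less that l by simp
    then show ?thesis unfolding l assms(1,2) by (intro sum.cong) auto
  qed (use assms in auto)
qed

text \<open>
The sequence \<open>w\<close> is \<open>\<Sum> z\<^sup>m / p'(z)\<close> over the conjugates \<open>z\<close>, since both sides satisfy the same recurrence
with the same initial values. Simplicity of the roots is what yields the rate \<open>conj_radius \<beta>\<close> itself,
without a polynomial factor; this is the rate that the metric on sequences can absorb.
\<close>
lemma impulse_response_asymptotics:
  fixes w :: "nat \<Rightarrow> int"
  assumes pisot: "pisot_number \<beta>" and d: "d = pisot_degree \<beta>"
    and rec: "\<And>m. w (m + d) = (\<Sum>i<d. - coeff (min_poly \<beta>) i * w (m + i))"
    and zero: "\<And>m. m < d - 1 \<Longrightarrow> w m = 0" and one: "w (d - 1) = 1"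
  obtains c C where "\<And>m. \<bar>of_int (w m) - c * \<beta> ^ m\<bar> \<le> C * conj_radius \<beta> ^ m"
proof -
  define P where "P = (map_poly of_int (min_poly \<beta>) :: complex poly)"
  have b: "algebraic_int \<beta>" using pisot by (auto simp: pisot_number_def)
  note mp = is_min_poly_min_poly[OF b]
  have sf: "rsquarefree P" unfolding P_def by (rule rsquarefree_min_poly[OF mp])
  have degP: "degree P = d" by (simp add: P_def d pisot_degree_def degree_map_poly)
  have monic: "lead_coeff P = 1" using mp by (simp add: degP d pisot_degree_def is_min_poly_def) (simp add: P_def coeff_map_poly)
  have d0: "d > 0" using degree_min_poly_pos[OF mp] by (simp add: d pisot_degree_def)
  define R where "R = galois_conjugates \<beta>"
  have R: "R = {z. poly P z = 0}" by (simp add: R_def galois_conjugates_def P_def)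
  have fin: "finite R" unfolding R using sf by (simp add: poly_roots_finite rsquarefree_def)
  define e where "e z = 1 / poly (pderiv P) z" for z
  have root: "z ^ d = (\<Sum>i<d. of_int (- coeff (min_poly \<beta>) i) * z ^ i)" if "z \<in> R" for z
  proof -
    have "0 = (\<Sum>i\<le>d. coeff P i * z ^ i)" using that by (simp add: R poly_altdef degP)
    also have "\<dots> = (\<Sum>i<d. coeff P i * z ^ i) + z ^ d"
      using monic by (simp add: degP flip: lessThan_Suc_atMost)
    finally show ?thesis by (simp add: sum_negf P_def coeff_map_poly add_eq_0_iff2)
  qed
  have w: "of_int (w m) = (\<Sum>z\<in>R. e z * z ^ m)" for m
  proof (rule linear_recurrence_unique[where a = "\<lambda>i. of_int (- coeff (min_poly \<beta>) i)" and d = d])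
    fix m
    show "of_int (w (m + d)) = (\<Sum>i<d. of_int (- coeff (min_poly \<beta>) i) * (of_int (w (m + i)) :: complex))"
      unfolding rec by simp
    have "(\<Sum>i<d. of_int (- coeff (min_poly \<beta>) i) * (\<Sum>z\<in>R. e z * z ^ (m + i)))
        = (\<Sum>z\<in>R. \<Sum>i<d. of_int (- coeff (min_poly \<beta>) i) * (e z * z ^ (m + i)))"
      unfolding sum_distrib_left by (rule sum.swap)
    also have "\<dots> = (\<Sum>z\<in>R. e z * z ^ m * z ^ d)"
    proof (rule sum.cong)
      fix z assume z: "z \<in> R"
      show "(\<Sum>i<d. of_int (- coeff (min_poly \<beta>) i) * (e z * z ^ (m + i))) = e z * z ^ m * z ^ d"
        unfolding root[OF z] sum_distrib_left by (simp add: power_add algebra_simps)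
    qed simp
    finally show "(\<Sum>z\<in>R. e z * z ^ (m + d))
        = (\<Sum>i<d. of_int (- coeff (min_poly \<beta>) i) * (\<Sum>z\<in>R. e z * z ^ (m + i)))"
      by (simp add: power_add mult.assoc)
    assume m: "m < d"
    have "(\<Sum>z\<in>R. e z * z ^ m) = (if m = d - 1 then 1 else 0)"
      using sum_power_over_pderiv[OF sf monic, of m] m by (simp add: degP R e_def)
    moreover have "w m = (if m = d - 1 then 1 else 0)" using zero[of m] one m by auto
    ultimately show "of_int (w m) = (\<Sum>z\<in>R. e z * z ^ m)" by simp
  qed
  define \<gamma> where "\<gamma> = conj_radius \<beta>"
  define S where "S = R - {of_real \<beta>}"
  have bR: "of_real \<beta> \<in> R"
  proof -
    have "poly P (of_real \<beta>) = of_real (poly (map_poly of_int (min_poly \<beta>)) \<beta>)"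
      by (simp add: P_def poly_altdef degree_map_poly coeff_map_poly)
    then show ?thesis using mp by (simp add: R is_min_poly_def)
  qed
  have "\<bar>of_int (w m) - Re (e (of_real \<beta>)) * \<beta> ^ m\<bar> \<le> (\<Sum>z\<in>S. cmod (e z)) * \<gamma> ^ m" for m
  proof -
    have "of_int (w m) - e (of_real \<beta>) * of_real \<beta> ^ m = (\<Sum>z\<in>S. e z * z ^ m)"
      unfolding w S_def using fin bR by (subst sum.remove[of R "of_real \<beta>"]) auto
    then have "\<bar>Re (of_int (w m) - e (of_real \<beta>) * of_real (\<beta> ^ m))\<bar> \<le> cmod (\<Sum>z\<in>S. e z * z ^ m)"
      using abs_Re_le_cmod[of "\<Sum>z\<in>S. e z * z ^ m"] by simp
    also have "\<dots> \<le> (\<Sum>z\<in>S. cmod (e z * z ^ m))" by (rule norm_sum)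
    also have "\<dots> \<le> (\<Sum>z\<in>S. cmod (e z) * \<gamma> ^ m)"
    proof (rule sum_mono)
      fix z assume "z \<in> S"
      then have "cmod z \<le> \<gamma>"
        using conj_radius_bounds(3)[OF pisot] by (simp add: S_def R_def \<gamma>_def)
      then show "cmod (e z * z ^ m) \<le> cmod (e z) * \<gamma> ^ m"
        by (simp add: norm_mult norm_power mult_left_mono power_mono)
    qed
    finally show ?thesis by (simp add: sum_distrib_right Re_complex_of_real)
  qed
  then show ?thesis using that unfolding \<gamma>_def by blast
qed

section \<open>Expansions in a numeration\<close>

lemma tendsto_enat_infinity_iff:
  "(f \<longlongrightarrow> (\<infinity>::enat)) F \<longleftrightarrow> (\<forall>k. \<forall>\<^sub>F n in F. enat k \<le> f n)"
proof
  assume f: "(f \<longlongrightarrow> \<infinity>) F"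
  show "\<forall>k. \<forall>\<^sub>F n in F. enat k \<le> f n"
  proof
    fix k
    have "\<forall>\<^sub>F n in F. enat k < f n" using f by (rule order_tendstoD) simp
    then show "\<forall>\<^sub>F n in F. enat k \<le> f n" by eventually_elim simp
  qed
next
  assume f: "\<forall>k. \<forall>\<^sub>F n in F. enat k \<le> f n"
  show "(f \<longlongrightarrow> \<infinity>) F"
  proof (rule order_tendstoI)
    fix l :: enat assume "l < \<infinity>"
    then obtain k where k: "l = enat k" by (cases l) auto
    have "\<forall>\<^sub>F n in F. enat (Suc k) \<le> f n" using f by blast
    then show "\<forall>\<^sub>F n in F. l < f n"
      by eventually_elim (simp add: k Suc_ile_eq)
  qed simp
qed

lemma enat_le_seq_ord_iff: "enat k \<le> seq_ord g \<longleftrightarrow> (\<forall>i<k. g i = 0)"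
  unfolding seq_ord_def le_INF_iff by (auto simp: not_le[symmetric])

lemma seq_value_eq_sum:
  assumes "finite A" "\<And>i. i \<notin> A \<Longrightarrow> g i = 0"
  shows "seq_value U g = (\<Sum>i\<in>A. g i * U i)"
  unfolding seq_value_def using assms by (intro sum.mono_neutral_left) auto

lemma seq_value_seq_prefix: "seq_value U (seq_prefix n g) = (\<Sum>i<n. g i * U i)"
  by (subst seq_value_eq_sum[where A = "{..<n}"]) (auto simp: seq_prefix_def)

lemma seq_prefix_finite: "seq_prefix n g \<in> finite_seqs"
  by (auto simp: seq_prefix_def finite_seqs_def)

lemma nu_minus: "nu U (- N) = nu U N"
  by (simp add: nu_def)

lemma finite_seqs_add: "g \<in> finite_seqs \<Longrightarrow> h \<in> finite_seqs \<Longrightarrow> (\<lambda>i. g i + h i) \<in> finite_seqs"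
  unfolding finite_seqs_def mem_Collect_eq
  by (rule finite_subset[of _ "{i. g i \<noteq> 0} \<union> {i. h i \<noteq> 0}"]) auto

lemma seq_value_add:
  assumes "g \<in> finite_seqs" "h \<in> finite_seqs"
  shows "seq_value U (\<lambda>i. g i + h i) = seq_value U g + seq_value U h"
proof -
  let ?A = "{i. g i \<noteq> 0} \<union> {i. h i \<noteq> 0}"
  have "finite ?A" using assms by (simp add: finite_seqs_def)
  then show ?thesis
    by (subst (1 2 3) seq_value_eq_sum[where A = ?A]) (auto simp: sum.distrib algebra_simps)
qed

text \<open>
The leading digit goes to the largest \<open>L\<close> with \<open>U L \<le> n\<close>. Although \<open>U\<close> need not be monotone, the
remainder modulo \<open>U L\<close> is below \<open>U l\<close> for all \<open>l \<ge> L\<close>, because \<open>L\<close> is maximal; so the induction can go on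
with smaller indices.
\<close>
lemma greedy_expansion:
  assumes pos: "\<And>i. U i > 0" and U0: "U 0 = 1" and fin: "\<And>n. finite {l. U l \<le> n}" and n: "n \<ge> 0"
  shows "greedy U n \<in> expansions U n" "(\<Sum>i\<le>l. greedy U n i * U i) < U (Suc l)"
proof -
  have ex: "\<exists>g\<in>expansions U n. \<forall>l. (\<Sum>i\<le>l. g i * U i) < U (Suc l)"
    using n
  proof (induction "nat n" arbitrary: n rule: less_induct)
    case less
    show ?case
    proof (cases "n = 0")
      case True
      then show ?thesis using pos
        by (intro bexI[of _ "\<lambda>_. 0"]) (auto simp: expansions_def finite_seqs_def seq_value_def)
    next
      case False
      define L where "L = Max {l. U l \<le> n}"
      have "0 \<in> {l. U l \<le> n}" using False less.prems U0 by simp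
      then have L: "U L \<le> n" using Max_in[OF fin[of n]] by (auto simp: L_def)
      have above: "n < U l" if "l > L" for l
        using Max_ge[OF fin[of n], of l] that by (auto simp: L_def not_le[symmetric])
      define k where "k = n mod U L"
      have k: "0 \<le> k" "k < U L" using pos[of L] by (auto simp: k_def)
      moreover have "k < n" using k L by simp
      ultimately have "nat k < nat n" by simp
      from less.hyps[OF this k(1)]
      obtain g where g: "g \<in> expansions U k" "\<And>l. (\<Sum>i\<le>l. g i * U i) < U (Suc l)" by blast
      have g0: "g i \<ge> 0" for i using g(1) by (simp add: expansions_def)
      have gf: "finite {i. g i \<noteq> 0}" and gv: "seq_value U g = k" using g(1) by (auto simp: expansions_def finite_seqs_def)
      have zero: "g i = 0" if "i \<ge> L" for i
      proof (rule ccontr)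
        assume i: "g i \<noteq> 0"
        have "U i \<le> g i * U i" using i g0[of i] pos[of i] by (simp add: mult_le_cancel_right1)
        also have "\<dots> \<le> seq_value U g"
          unfolding seq_value_def using i gf g0 pos
          by (intro member_le_sum) (auto intro: mult_nonneg_nonneg less_imp_le)
        finally have "U i \<le> k" using gv by simp
        moreover have "k < U i" using that k L above[of i] by (cases "i = L") auto
        ultimately show False by simp
      qed
      have lt: "i < L" if "g i \<noteq> 0" for i using zero that not_le by blast
      define e where "e = g(L := n div U L)"
      have split: "(\<Sum>i\<in>A. e i * U i) = (\<Sum>i\<in>A. g i * U i) + (if L \<in> A then n div U L * U L else 0)"
        if "finite A" for A
      proof -
        have "(\<Sum>i\<in>A. e i * U i) = (\<Sum>i\<in>A. g i * U i + (if i = L then n div U L * U L else 0))"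
          by (intro sum.cong) (auto simp: e_def zero)
        then show ?thesis using that by (simp add: sum.distrib)
      qed
      have gsum: "(\<Sum>i\<le>l. g i * U i) = k" if "l \<ge> L" for l
        using seq_value_eq_sum[of "{..l}" g U] zero that gv by (simp add: not_le)
      have n_eq: "k + n div U L * U L = n" unfolding k_def by simp
      have "e \<in> finite_seqs" unfolding finite_seqs_def mem_Collect_eq
        by (rule finite_subset[of _ "{..L}"]) (use lt in \<open>auto simp: e_def less_imp_le split: if_splits\<close>)
      moreover have "e i \<ge> 0" for i
        using g0[of i] less.prems pos[of L] by (simp add: e_def pos_imp_zdiv_nonneg_iff)
      moreover have "seq_value U e = (\<Sum>i\<le>L. e i * U i)"
        by (rule seq_value_eq_sum) (use zero in \<open>auto simp: e_def\<close>)
      then have "seq_value U e = n" using split[of "{..L}"] gsum[of L] n_eq by simp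
      ultimately have "e \<in> expansions U n" by (simp add: expansions_def)
      moreover have "(\<Sum>i\<le>l. e i * U i) < U (Suc l)" for l
      proof (cases "l < L")
        case True
        then show ?thesis using g(2)[of l] split[of "{..l}"] by simp
      next
        case False
        then show ?thesis using split[of "{..l}"] gsum[of l] n_eq above[of "Suc l"] by simp
      qed
      ultimately show ?thesis by blast
    qed
  qed
  then obtain g where g: "g \<in> expansions U n" "\<And>l. (\<Sum>i\<le>l. g i * U i) < U (Suc l)" by blast
  have lex: "\<forall>h\<in>expansions U n. h \<noteq> g \<longrightarrow> lex_less h g"
    using greedy_characterisation[OF pos U0 g(1)] g(2) by blast
  have asym: False if gh: "lex_less a b" and hg: "lex_less b a" for a b
  proof -
    obtain k where k: "a k < b k" "\<forall>j>k. a j = b j" using gh by (auto simp: lex_less_def)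
    obtain l where l: "b l < a l" "\<forall>j>l. b j = a j" using hg by (auto simp: lex_less_def)
    show False using k l by (metis less_irrefl linorder_neqE_nat less_asym)
  qed
  have "greedy U n = g"
    unfolding greedy_def
  proof (rule the_equality)
    fix h assume h: "h \<in> expansions U n \<and> (\<forall>e\<in>expansions U n. e \<noteq> h \<longrightarrow> lex_less e h)"
    show "h = g"
    proof (rule ccontr)
      assume "h \<noteq> g"
      then have "lex_less h g" "lex_less g h" using h g(1) lex by auto
      then show False by (rule asym)
    qed
  qed (use g(1) lex in simp)
  then show "greedy U n \<in> expansions U n" "(\<Sum>i\<le>l. greedy U n i * U i) < U (Suc l)"
    using g by auto
qed

text \<open>
The digit \<open>g\<^sub>i\<close> of a normalised expansion satisfies \<open>g\<^sub>i U\<^sub>i < U\<^bsub>i+1\<^esub>\<close>, so bounded ratios bound all digits.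
\<close>
lemma bounded_expansion_of_order_nu:
  assumes pos: "\<And>i. U i > 0" and U0: "U 0 = 1" and fin: "\<And>n. finite {l. U l \<le> n}"
    and ratio: "\<And>i. U (Suc i) \<le> B * U i"
  obtains e where "e \<in> finite_seqs" "seq_value U e = N" "seq_ord e = nu U N" "\<And>i. \<bar>e i\<bar> \<le> B"
proof -
  define g where "g = greedy U \<bar>N\<bar>"
  have g: "g \<in> expansions U \<bar>N\<bar>" "\<And>l. (\<Sum>i\<le>l. g i * U i) < U (Suc l)"
    unfolding g_def using greedy_expansion[OF pos U0 fin, of "\<bar>N\<bar>"] by auto
  have g0: "g i \<ge> 0" for i using g(1) by (simp add: expansions_def)
  have gB: "g i \<le> B" for i
  proof -
    have "g i * U i \<le> (\<Sum>i\<le>i. g i * U i)"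
      using g0 pos by (intro member_le_sum) (auto intro: mult_nonneg_nonneg less_imp_le)
    also have "\<dots> < U (Suc i)" by (rule g)
    also have "\<dots> \<le> B * U i" by (rule ratio)
    finally show ?thesis using pos[of i] by simp
  qed
  define e where "e i = (if N < 0 then - g i else g i)" for i
  have nz: "e i = 0 \<longleftrightarrow> g i = 0" for i by (simp add: e_def)
  show ?thesis
  proof
    show "e \<in> finite_seqs" using g(1) by (simp add: expansions_def finite_seqs_def nz)
    show "seq_ord e = nu U N" by (simp add: seq_ord_def nu_def nz g_def)
    show "\<bar>e i\<bar> \<le> B" for i using g0[of i] gB[of i] by (simp add: e_def)
    have "seq_value U e = (if N < 0 then - seq_value U g else seq_value U g)"
      unfolding seq_value_def by (simp add: nz) (simp add: e_def sum_negf)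
    then show "seq_value U e = N" using g(1) by (simp add: expansions_def)
  qed
qed

section \<open>The group of bounded sequences\<close>

lemma bounded_range_intE:
  fixes g :: "nat \<Rightarrow> int"
  assumes "bounded (range g)"
  obtains B :: int where "B \<ge> 0" "\<And>i. \<bar>g i\<bar> \<le> B"
proof -
  obtain b :: real where b: "\<And>i. norm (g i) \<le> b" using assms by (auto simp: bounded_iff)
  have "\<bar>g i\<bar> \<le> \<lceil>b\<rceil>" for i
  proof -
    have "of_int \<bar>g i\<bar> \<le> b" using b[of i] by simp
    then show ?thesis by (simp add: le_ceiling_iff less_le_trans)
  qed
  moreover from this have "\<lceil>b\<rceil> \<ge> 0" using abs_ge_zero[of "g 0"] order_trans by blast
  ultimately show ?thesis using that by blast
qed

lemma bounded_range_intI: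
  fixes g :: "nat \<Rightarrow> int"
  assumes "\<And>i. \<bar>g i\<bar> \<le> B"
  shows "bounded (range g)"
proof -
  have "norm (g i) \<le> of_int B" for i
    using assms[of i] by simp
  then show ?thesis by (auto simp: bounded_iff)
qed

lemma carrier_bounded_seq_group: "carrier bounded_seq_group = {g. bounded (range g)}"
  by (simp add: bounded_seq_group_def)

lemma comm_group_bounded_seq_group: "comm_group bounded_seq_group"
proof (rule comm_groupI)
  fix x y assume "x \<in> carrier bounded_seq_group" "y \<in> carrier bounded_seq_group"
  then obtain A B where AB: "\<And>i. \<bar>x i\<bar> \<le> A" "\<And>i. \<bar>y i\<bar> \<le> B"
    by (auto simp: carrier_bounded_seq_group elim!: bounded_range_intE)
  have "\<bar>x i + y i\<bar> \<le> A + B" for i using AB(1)[of i] AB(2)[of i] by linarith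
  then have "bounded (range (\<lambda>i. x i + y i))" by (rule bounded_range_intI)
  then show "x \<otimes>\<^bsub>bounded_seq_group\<^esub> y \<in> carrier bounded_seq_group"
    by (simp add: bounded_seq_group_def)
next
  fix x assume "x \<in> carrier bounded_seq_group"
  then obtain A where "\<And>i. \<bar>x i\<bar> \<le> A"
    by (auto simp: carrier_bounded_seq_group elim!: bounded_range_intE)
  then have "bounded (range (\<lambda>i. - x i))" by (intro bounded_range_intI[of _ A]) simp
  then show "\<exists>y\<in>carrier bounded_seq_group. y \<otimes>\<^bsub>bounded_seq_group\<^esub> x = \<one>\<^bsub>bounded_seq_group\<^esub>"
    by (intro bexI[of _ "\<lambda>i. - x i"]) (auto simp: bounded_seq_group_def)
qed (auto simp: bounded_seq_group_def algebra_simps)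

lemma inv_bounded_seq_group:
  assumes "g \<in> carrier bounded_seq_group"
  shows "inv\<^bsub>bounded_seq_group\<^esub> g = (\<lambda>i. - g i)"
proof -
  interpret comm_group bounded_seq_group by (rule comm_group_bounded_seq_group)
  obtain A where "\<And>i. \<bar>g i\<bar> \<le> A"
    using assms by (auto simp: carrier_bounded_seq_group elim!: bounded_range_intE)
  then have "bounded (range (\<lambda>i. - g i))" by (intro bounded_range_intI[of _ A]) simp
  then have "(\<lambda>i. - g i) \<in> carrier bounded_seq_group" by (simp add: bounded_seq_group_def)
  then show ?thesis using assms by (intro inv_equality) (auto simp: bounded_seq_group_def)
qed

text \<open>
On sequences with digits below a fixed bound the metric is controlled by the length of the common
prefix, as in the product topology. On unbounded sets of digits this fails.
\<close>
lemma seq_dist_agreeing_prefix: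
  assumes \<gamma>: "0 < \<gamma>" "\<gamma> < 1" and g: "\<And>i. \<bar>g i\<bar> \<le> B" and h: "\<And>i. \<bar>h i\<bar> \<le> B"
    and eq: "\<And>i. i < n \<Longrightarrow> g i = h i"
  shows "seq_dist \<gamma> g h \<le> 2 * of_int B / (1 - \<gamma>) * \<gamma> ^ n"
proof -
  let ?s = "\<lambda>i. of_int \<bar>g i - h i\<bar> * \<gamma> ^ i :: real"
  have le: "?s i \<le> 2 * of_int B * \<gamma> ^ i" for i
  proof -
    have "\<bar>g i - h i\<bar> \<le> 2 * B" using g[of i] h[of i] by linarith
    then have "real_of_int \<bar>g i - h i\<bar> \<le> of_int (2 * B)" by (simp only: of_int_le_iff)
    then show ?thesis using \<gamma> by (simp add: mult_right_mono)
  qed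
  have geo: "(\<lambda>i. 2 * of_int B * \<gamma> ^ (i + n)) sums (2 * of_int B * \<gamma> ^ n * (1 / (1 - \<gamma>)))"
    using sums_mult[OF geometric_sums[of \<gamma>], of "2 * of_int B * \<gamma> ^ n"] \<gamma> by (simp add: power_add mult_ac)
  have "summable (\<lambda>i. 2 * of_int B * \<gamma> ^ i)" using \<gamma> by (intro summable_mult summable_geometric) simp
  then have s: "summable ?s"
    by (rule summable_comparison_test') (use le \<gamma> in simp)
  have s': "summable (\<lambda>i. ?s (i + n))" using s by (subst summable_iff_shift)
  have "suminf ?s = (\<Sum>i. ?s (i + n)) + (\<Sum>i<n. ?s i)" using s by (rule suminf_split_initial_segment)
  also have "(\<Sum>i<n. ?s i) = 0" using eq by (intro sum.neutral) auto
  also have "(\<Sum>i. ?s (i + n)) \<le> 2 * of_int B * \<gamma> ^ n * (1 / (1 - \<gamma>))"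
    using suminf_le[OF le s' sums_summable[OF geo]] sums_unique[OF geo] by simp
  finally have "suminf ?s \<le> 2 * of_int B / (1 - \<gamma>) * \<gamma> ^ n" by simp
  moreover have "g \<in> carrier bounded_seq_group" "h \<in> carrier bounded_seq_group"
    using g h by (auto simp: carrier_bounded_seq_group intro: bounded_range_intI)
  ultimately show ?thesis by (simp add: seq_dist_def)
qed

text \<open>
The set is a continuous image of a product of finite discrete spaces.
\<close>
lemma compactin_bounded_digits:
  assumes \<gamma>: "0 < \<gamma>" "\<gamma> < 1"
  shows "compactin (Metric_space.mtopology (carrier bounded_seq_group) (seq_dist \<gamma>)) {g. \<forall>i. \<bar>g i\<bar> \<le> B}"
proof -
  interpret Metric_space "carrier bounded_seq_group" "seq_dist \<gamma>" by (rule Metric_space_seq_dist[OF \<gamma>])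
  define P where "P = product_topology (\<lambda>_::nat. discrete_topology {-B..B}) UNIV"
  have top: "topspace P = {g. \<forall>i. \<bar>g i\<bar> \<le> B}"
    by (auto simp: P_def PiE_UNIV_domain abs_le_iff minus_le_iff)
  have "compact_space P"
    unfolding P_def compact_space_product_topology by (simp add: compact_space_discrete_topology)
  then have "compactin P {g. \<forall>i. \<bar>g i\<bar> \<le> B}" by (simp add: compact_space_def top)
  moreover have "continuous_map P mtopology (\<lambda>g. g)"
    unfolding continuous_map_to_metric
  proof (intro ballI allI impI)
    fix g and \<epsilon> :: real assume g: "g \<in> topspace P" and "\<epsilon> > 0"
    have "(\<lambda>n. 2 * of_int B / (1 - \<gamma>) * \<gamma> ^ n) \<longlonglongrightarrow> 0"
      using \<gamma> by (intro tendsto_mult_right_zero LIMSEQ_realpow_zero) auto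
    from order_tendstoD(2)[OF this \<open>\<epsilon> > 0\<close>] obtain n where n: "2 * of_int B / (1 - \<gamma>) * \<gamma> ^ n < \<epsilon>"
      by (auto simp: eventually_sequentially)
    define V where "V = (\<Pi>\<^sub>E i\<in>UNIV. if i < n then {g i} else {-B..B})"
    have "openin P V"
      unfolding P_def V_def openin_PiE_gen
    proof (intro disjI2 conjI ballI)
      show "finite {i \<in> UNIV. (if i < n then {g i} else {-B..B}) \<noteq> topspace (discrete_topology {-B..B})}"
        by (rule finite_subset[of _ "{..<n}"]) auto
      fix i :: nat
      show "openin (discrete_topology {-B..B}) (if i < n then {g i} else {-B..B})"
        using g by (auto simp: top abs_le_iff minus_le_iff)
    qed
    moreover have "g \<in> V" using g by (auto simp: V_def top abs_le_iff minus_le_iff)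
    moreover have "h \<in> mball g \<epsilon>" if h: "h \<in> V" for h
    proof -
      have gB: "\<bar>g i\<bar> \<le> B" for i using g by (simp add: top)
      have eq: "g i = h i" if "i < n" for i
        using PiE_mem[OF h[unfolded V_def], of i] that by simp
      have hB: "\<bar>h i\<bar> \<le> B" for i
      proof (cases "i < n")
        case True
        then show ?thesis using eq gB[of i] by simp
      next
        case False
        then show ?thesis using PiE_mem[OF h[unfolded V_def], of i] by auto
      qed
      have "seq_dist \<gamma> g h < \<epsilon>"
        using seq_dist_agreeing_prefix[where n = n, OF \<gamma> gB hB] eq n by fastforce
      moreover have "g \<in> carrier bounded_seq_group" "h \<in> carrier bounded_seq_group"
        using gB hB by (auto simp: carrier_bounded_seq_group intro: bounded_range_intI)
      ultimately show ?thesis by simp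
    qed
    ultimately show "\<exists>V. openin P V \<and> g \<in> V \<and> (\<forall>y\<in>V. y \<in> mball g \<epsilon>)" by blast
  qed
  ultimately have "compactin mtopology ((\<lambda>g. g) ` {g. \<forall>i. \<bar>g i\<bar> \<le> B})" by (rule image_compactin)
  then show ?thesis by simp
qed

section \<open>Maps onto the torus\<close>

abbreviation real_space :: "nat \<Rightarrow> (nat \<Rightarrow> real) topology" where
  "real_space m \<equiv> product_topology (\<lambda>_. euclideanreal) {..<m}"

lemma topspace_real_space: "topspace (real_space m) = extensional {..<m}"
  by (simp add: PiE_def)

lemma carrier_real_space_group: "carrier (real_space_group m) = extensional {..<m}"
  by (simp add: real_space_group_def real_add_group_def PiE_def)

lemma mult_real_space_group: "x \<otimes>\<^bsub>real_space_group m\<^esub> y = (\<lambda>i\<in>{..<m}. x i + y i)"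
  by (simp add: real_space_group_def real_add_group_def)

lemma one_real_space_group: "\<one>\<^bsub>real_space_group m\<^esub> = (\<lambda>i\<in>{..<m}. 0)"
  by (simp add: real_space_group_def real_add_group_def)

lemma comm_group_real_space_group: "comm_group (real_space_group m)"
proof (rule comm_groupI)
  fix x assume "x \<in> carrier (real_space_group m)"
  show "\<exists>y\<in>carrier (real_space_group m). y \<otimes>\<^bsub>real_space_group m\<^esub> x = \<one>\<^bsub>real_space_group m\<^esub>"
    by (intro bexI[of _ "\<lambda>i\<in>{..<m}. - x i"])
      (auto simp: carrier_real_space_group mult_real_space_group one_real_space_group)
qed (auto simp: carrier_real_space_group mult_real_space_group one_real_space_group fun_eq_iff extensional_def)

lemma inv_real_space_group:
  assumes "x \<in> extensional {..<m}"
  shows "inv\<^bsub>real_space_group m\<^esub> x = (\<lambda>i\<in>{..<m}. - x i)"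
proof -
  interpret comm_group "real_space_group m" by (rule comm_group_real_space_group)
  show ?thesis using assms
    by (intro inv_equality) (auto simp: carrier_real_space_group mult_real_space_group one_real_space_group)
qed

lemma mem_integer_lattice_iff:
  "x \<in> integer_lattice m \<longleftrightarrow> x \<in> extensional {..<m} \<and> (\<forall>i<m. x i \<in> \<int>)"
  unfolding integer_lattice_def PiE_iff by auto

lemma integer_lattice_normal: "integer_lattice m \<lhd> real_space_group m"
proof -
  interpret comm_group "real_space_group m" by (rule comm_group_real_space_group)
  have "subgroup (integer_lattice m) (real_space_group m)"
  proof (rule subgroupI)
    show "integer_lattice m \<subseteq> carrier (real_space_group m)"
      by (auto simp: mem_integer_lattice_iff carrier_real_space_group)
    have "(\<lambda>i\<in>{..<m}. 0) \<in> integer_lattice m" by (simp add: mem_integer_lattice_iff)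
    then show "integer_lattice m \<noteq> {}" by blast
    fix x assume x: "x \<in> integer_lattice m"
    then have "x \<in> extensional {..<m}" by (simp add: mem_integer_lattice_iff)
    then show "inv\<^bsub>real_space_group m\<^esub> x \<in> integer_lattice m"
      using x by (simp add: inv_real_space_group mem_integer_lattice_iff)
    fix y assume "y \<in> integer_lattice m"
    then show "x \<otimes>\<^bsub>real_space_group m\<^esub> y \<in> integer_lattice m"
      using x by (simp add: mult_real_space_group mem_integer_lattice_iff)
  qed
  then show ?thesis by (rule subgroup_imp_normal)
qed

lemma integer_lattice_coset_eq_iff:
  assumes x: "x \<in> extensional {..<m}" and y: "y \<in> extensional {..<m}"
  shows "integer_lattice m #>\<^bsub>real_space_group m\<^esub> x = integer_lattice m #>\<^bsub>real_space_group m\<^esub> y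
    \<longleftrightarrow> (\<forall>i<m. x i - y i \<in> \<int>)"
proof -
  interpret normal "integer_lattice m" "real_space_group m" by (rule integer_lattice_normal)
  have coset: "z \<in> integer_lattice m #>\<^bsub>real_space_group m\<^esub> u \<longleftrightarrow> z \<in> extensional {..<m} \<and> (\<forall>i<m. z i - u i \<in> \<int>)"
    if u: "u \<in> extensional {..<m}" for z u
  proof
    assume "z \<in> integer_lattice m #>\<^bsub>real_space_group m\<^esub> u"
    then obtain h where "h \<in> integer_lattice m" "z = (\<lambda>i\<in>{..<m}. h i + u i)"
      by (auto simp: r_coset_def mult_real_space_group)
    then show "z \<in> extensional {..<m} \<and> (\<forall>i<m. z i - u i \<in> \<int>)"
      by (simp add: mem_integer_lattice_iff)
  next
    assume z: "z \<in> extensional {..<m} \<and> (\<forall>i<m. z i - u i \<in> \<int>)"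
    define h where "h = (\<lambda>i\<in>{..<m}. z i - u i)"
    have "h \<in> integer_lattice m" using z by (simp add: h_def mem_integer_lattice_iff)
    moreover have "z = h \<otimes>\<^bsub>real_space_group m\<^esub> u"
      using z by (auto simp: h_def mult_real_space_group fun_eq_iff extensional_def)
    ultimately show "z \<in> integer_lattice m #>\<^bsub>real_space_group m\<^esub> u"
      by (auto simp: r_coset_def)
  qed
  show ?thesis
  proof
    assume eq: "integer_lattice m #>\<^bsub>real_space_group m\<^esub> x = integer_lattice m #>\<^bsub>real_space_group m\<^esub> y"
    have "x \<in> integer_lattice m #>\<^bsub>real_space_group m\<^esub> x" using x by (simp add: coset)
    then show "\<forall>i<m. x i - y i \<in> \<int>" unfolding eq using y by (simp add: coset)
  next
    assume xy: "\<forall>i<m. x i - y i \<in> \<int>"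
    have iff: "z i - x i \<in> \<int> \<longleftrightarrow> z i - y i \<in> \<int>" if "i < m" for z i
    proof -
      have i: "x i - y i \<in> \<int>" using xy that by blast
      show ?thesis using Ints_add[OF _ i, of "z i - x i"] Ints_diff[OF _ i, of "z i - y i"] by auto
    qed
    show "integer_lattice m #>\<^bsub>real_space_group m\<^esub> x = integer_lattice m #>\<^bsub>real_space_group m\<^esub> y"
      by (auto simp: coset x y iff)
  qed
qed

lemma cis_2pi_eq_iff: "cis (2 * pi * x) = cis (2 * pi * y) \<longleftrightarrow> x - y \<in> \<int>"
proof -
  have "cis (2 * pi * x) = cis (2 * pi * y) \<longleftrightarrow> cis (2 * pi * (x - y)) = 1"
    by (simp add: right_diff_distrib cis_divide[symmetric])
  also have "\<dots> \<longleftrightarrow> cos (2 * pi * (x - y)) = 1"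
    by (auto simp: complex_eq_iff cos_one_2pi_int)
  also have "\<dots> \<longleftrightarrow> x - y \<in> \<int>"
    by (auto simp: cos_one_2pi_int Ints_def)
  finally show ?thesis .
qed

text \<open>
The set is the preimage of the compact image of \<open>K\<close> under \<open>x \<mapsto> (exp (2\<pi>i x\<^sub>j))\<^sub>j\<close>, whose fibres are the
cosets of the integer lattice and whose target is Hausdorff.
\<close>
lemma closedin_integer_translates:
  assumes K: "compactin (real_space m) K"
  shows "closedin (real_space m) {y \<in> extensional {..<m}. \<exists>x\<in>K. \<forall>i<m. y i - x i \<in> \<int>}"
proof -
  define Y where "Y = product_topology (\<lambda>_::nat. euclidean :: complex topology) {..<m}"
  define E where "E x = (\<lambda>i\<in>{..<m}. cis (2 * pi * x i))" for x :: "nat \<Rightarrow> real"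
  have cont: "continuous_map (real_space m) Y E"
    unfolding Y_def continuous_map_componentwise
  proof (intro conjI ballI)
    fix k assume k: "k \<in> {..<m}"
    have "continuous_map euclideanreal euclidean (\<lambda>t. cis (2 * pi * t))"
      by (simp add: continuous_intros)
    from continuous_map_compose[OF continuous_map_product_projection[OF k] this]
    show "continuous_map (real_space m) euclidean (\<lambda>x. E x k)"
      using k by (simp add: E_def o_def)
  qed (auto simp: E_def)
  have "Hausdorff_space Y"
    by (simp add: Y_def Hausdorff_space_product_topology)
  then have "closedin Y (E ` K)" by (intro compactin_imp_closedin image_compactin[OF K cont])
  from closedin_continuous_map_preimage[OF cont this]
  have "closedin (real_space m) {y \<in> topspace (real_space m). E y \<in> E ` K}" .
  also have "{y \<in> topspace (real_space m). E y \<in> E ` K} = {y \<in> extensional {..<m}. \<exists>x\<in>K. \<forall>i<m. y i - x i \<in> \<int>}"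
    unfolding topspace_real_space
    by (auto simp: E_def image_iff fun_eq_iff restrict_def cis_2pi_eq_iff)
  finally show ?thesis .
qed

lemma torus_quotient_map:
  "quotient_map (real_space m) (torus_topology m) (\<lambda>x. integer_lattice m #>\<^bsub>real_space_group m\<^esub> x)"
  unfolding torus_topology_def by (rule quotient_map_quotient_topology)

text \<open>
Translates of a compact set by the lattice form a closed set, so density is enough to meet every coset.
\<close>
lemma compact_onto_torus:
  assumes cont: "continuous_map X (real_space m) f" and K: "compactin X K"
    and dense: "\<And>x \<epsilon>. \<epsilon> > 0 \<Longrightarrow> \<exists>g\<in>K. \<exists>z::nat \<Rightarrow> int. \<forall>i<m. \<bar>f g i - of_int (z i) - x i\<bar> < \<epsilon>"
    and x: "x \<in> extensional {..<m}"
  shows "\<exists>g\<in>K. \<forall>i<m. x i - f g i \<in> \<int>"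
proof -
  define S where "S = {y \<in> extensional {..<m}. \<exists>u\<in>f ` K. \<forall>i<m. y i - u i \<in> \<int>}"
  have closed: "closedin (real_space m) S"
    unfolding S_def by (intro closedin_integer_translates image_compactin[OF K cont])
  have "\<forall>n. \<exists>g\<in>K. \<exists>z::nat \<Rightarrow> int. \<forall>i<m. \<bar>f g i - of_int (z i) - x i\<bar> < inverse (real (Suc n))"
    by (intro allI dense) simp
  then obtain g and z :: "nat \<Rightarrow> nat \<Rightarrow> int" where g: "\<And>n. g n \<in> K"
    and z: "\<And>n i. i < m \<Longrightarrow> \<bar>f (g n) i - of_int (z n i) - x i\<bar> < inverse (real (Suc n))"
    by metis
  define y where "y n = (\<lambda>i\<in>{..<m}. f (g n) i - of_int (z n i))" for n
  have yS: "y n \<in> S" for n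
    using g by (auto simp: S_def y_def intro!: bexI[of _ "g n"])
  have "limitin (real_space m) y x sequentially"
    unfolding limitin_componentwise
  proof (intro conjI ballI)
    show "\<forall>\<^sub>F n in sequentially. y n \<in> topspace (real_space m)"
      unfolding topspace_real_space by (simp add: y_def)
    fix i assume i: "i \<in> {..<m}"
    have "(\<lambda>n. y n i) \<longlonglongrightarrow> x i"
    proof (rule LIMSEQ_I)
      fix e :: real assume "e > 0"
      then obtain N where N: "inverse (real (Suc N)) < e" using reals_Archimedean by blast
      have "norm (y n i - x i) < e" if "n \<ge> N" for n
      proof -
        have "inverse (real (Suc n)) \<le> inverse (real (Suc N))" using that by (intro le_imp_inverse_le) auto
        moreover have "norm (y n i - x i) < inverse (real (Suc n))"
          using z[of i n] i by (simp add: y_def)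
        ultimately show ?thesis using N by linarith
      qed
      then show "\<exists>N. \<forall>n\<ge>N. norm (y n i - x i) < e" by blast
    qed
    then show "limitin euclideanreal (\<lambda>n. y n i) (x i) sequentially" by simp
  qed (use x in auto)
  then have "x \<in> S"
    by (rule limitin_closedin[OF _ closed]) (auto simp: yS)
  then show ?thesis by (auto simp: S_def)
qed

text \<open>
A set of cosets whose preimage in \<open>X\<close> is closed is already the image of the compact part \<open>K\<close> of this
preimage, and images of compact sets are closed in the torus.
\<close>
lemma quotient_map_onto_torus:
  assumes cont: "continuous_map X (real_space m) f" and K: "compactin X K"
    and onto: "\<And>x. x \<in> extensional {..<m} \<Longrightarrow> \<exists>g\<in>K. \<forall>i<m. x i - f g i \<in> \<int>"
  shows "quotient_map X (torus_topology m) (\<lambda>g. integer_lattice m #>\<^bsub>real_space_group m\<^esub> f g)"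
proof -
  define p where "p x = integer_lattice m #>\<^bsub>real_space_group m\<^esub> x" for x
  have quot: "quotient_map (real_space m) (torus_topology m) p"
    unfolding p_def by (rule torus_quotient_map)
  have fX: "f g \<in> extensional {..<m}" if "g \<in> topspace X" for g
    using continuous_map_funspace[OF cont] that topspace_real_space by auto
  have KX: "K \<subseteq> topspace X" using K by (rule compactin_subset_topspace)
  have peq: "p x = p y \<longleftrightarrow> (\<forall>i<m. x i - y i \<in> \<int>)" if "x \<in> extensional {..<m}" "y \<in> extensional {..<m}" for x y
    unfolding p_def using that by (rule integer_lattice_coset_eq_iff)
  have contp: "continuous_map X (torus_topology m) (p \<circ> f)"
    using cont quotient_imp_continuous_map[OF quot] by (rule continuous_map_compose)
  have "quotient_map X (torus_topology m) (p \<circ> f)"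
    unfolding quotient_map_closedin
  proof (intro conjI allI impI)
    show "(p \<circ> f) ` topspace X = topspace (torus_topology m)"
    proof
      show "(p \<circ> f) ` topspace X \<subseteq> topspace (torus_topology m)"
        using continuous_map_funspace[OF contp] by auto
      show "topspace (torus_topology m) \<subseteq> (p \<circ> f) ` topspace X"
      proof
        fix t assume "t \<in> topspace (torus_topology m)"
        then obtain x where x: "x \<in> extensional {..<m}" "t = p x"
          using quotient_imp_surjective_map[OF quot] unfolding topspace_real_space by blast
        then obtain g where g: "g \<in> K" "\<forall>i<m. x i - f g i \<in> \<int>" using onto by blast
        then have "g \<in> topspace X" using KX by blast
        then have "t = p (f g)" unfolding x(2) using peq[OF x(1) fX] g(2) by simp
        then show "t \<in> (p \<circ> f) ` topspace X" using g KX by auto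
      qed
    qed
    fix V assume V: "V \<subseteq> topspace (torus_topology m)"
    show "closedin X {g \<in> topspace X. (p \<circ> f) g \<in> V} \<longleftrightarrow> closedin (torus_topology m) V"
    proof
      assume "closedin (torus_topology m) V"
      then show "closedin X {g \<in> topspace X. (p \<circ> f) g \<in> V}"
        by (rule closedin_continuous_map_preimage[OF contp])
    next
      assume cl: "closedin X {g \<in> topspace X. (p \<circ> f) g \<in> V}"
      define L where "L = {g \<in> topspace X. (p \<circ> f) g \<in> V} \<inter> K"
      have "compactin X L" unfolding L_def by (rule closed_Int_compactin[OF cl K])
      then have "closedin (real_space m) {y \<in> extensional {..<m}. \<exists>x\<in>f ` L. \<forall>i<m. y i - x i \<in> \<int>}"
        by (intro closedin_integer_translates image_compactin[OF _ cont])
      also have "{y \<in> extensional {..<m}. \<exists>x\<in>f ` L. \<forall>i<m. y i - x i \<in> \<int>} = {y \<in> topspace (real_space m). p y \<in> V}"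
        unfolding topspace_real_space
      proof (intro Collect_cong conj_cong refl)
        fix y :: "nat \<Rightarrow> real" assume y: "y \<in> extensional {..<m}"
        show "(\<exists>x\<in>f ` L. \<forall>i<m. y i - x i \<in> \<int>) \<longleftrightarrow> p y \<in> V"
        proof
          assume "\<exists>x\<in>f ` L. \<forall>i<m. y i - x i \<in> \<int>"
          then obtain g where g: "g \<in> topspace X" "p (f g) \<in> V" "\<forall>i<m. y i - f g i \<in> \<int>"
            by (auto simp: L_def)
          then have "p y = p (f g)" using peq[OF y fX[OF g(1)]] by blast
          then show "p y \<in> V" using g by simp
        next
          assume yV: "p y \<in> V"
          obtain g where g: "g \<in> K" "\<forall>i<m. y i - f g i \<in> \<int>" using onto[OF y] by blast
          then have "p y = p (f g)" using peq[OF y fX] KX by auto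
          then have "g \<in> L" using g yV KX by (auto simp: L_def)
          then show "\<exists>x\<in>f ` L. \<forall>i<m. y i - x i \<in> \<int>" using g by blast
        qed
      qed
      finally show "closedin (torus_topology m) V"
        using quot V unfolding quotient_map_closedin by blast
    qed
  qed
  then show ?thesis by (simp add: o_def p_def)
qed

section \<open>Numerations as impulse responses\<close>

text \<open>
The sequence \<open>w\<close> is the impulse response of the recurrence: it is \<open>U\<close> preceded by its \<open>d - 1\<close>
initial zeros, shifted so that the indices are natural numbers.
\<close>
locale pisot_recurrence =
  fixes d :: nat and a w U :: "nat \<Rightarrow> int" and \<beta> \<gamma> c C :: real
  assumes d_pos: "d > 0"
    and w_zero: "\<And>m. m < d - 1 \<Longrightarrow> w m = 0" and w_one: "w (d - 1) = 1"
    and w_rec: "\<And>m. w (m + d) = (\<Sum>i<d. a i * w (m + i))"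
    and U_eq: "\<And>n. U n = w (n + (d - 1))"
    and U_pos: "\<And>n. U n > 0"
    and beta: "1 < \<beta>" and gamma: "0 < \<gamma>" "\<gamma> < 1"
    and beta_rec: "\<beta> ^ d = (\<Sum>i<d. of_int (a i) * \<beta> ^ i)"
    and indep: "\<And>(q :: nat \<Rightarrow> int) i. (\<Sum>i<d. of_int (q i) * \<beta> ^ i) = 0 \<Longrightarrow> i < d \<Longrightarrow> q i = 0"
    and asymptotics: "\<And>m. \<bar>of_int (w m) - c * \<beta> ^ m\<bar> \<le> C * \<gamma> ^ m"
begin

text \<open>
The part of \<open>w\<close> that comes from the conjugates other than \<open>\<beta>\<close>.
\<close>
definition transient :: "nat \<Rightarrow> real" where "transient m = of_int (w m) - c * \<beta> ^ m"

lemma C_nonneg: "0 \<le> C"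
  using asymptotics[of 0] by simp

lemma transient_le: "\<bar>transient m\<bar> \<le> C * \<gamma> ^ m"
  by (simp add: transient_def asymptotics)

lemma transient_rec: "transient (m + d) = (\<Sum>i<d. of_int (a i) * transient (m + i))"
proof -
  have "transient (m + d) = of_int (\<Sum>i<d. a i * w (m + i)) - c * \<beta> ^ m * (\<Sum>i<d. of_int (a i) * \<beta> ^ i)"
    unfolding transient_def w_rec power_add beta_rec by (simp add: mult.assoc)
  also have "\<dots> = (\<Sum>i<d. of_int (a i) * of_int (w (m + i)) - c * \<beta> ^ m * (of_int (a i) * \<beta> ^ i))"
    by (simp add: sum_subtractf sum_distrib_left)
  also have "\<dots> = (\<Sum>i<d. of_int (a i) * transient (m + i))"
    by (intro sum.cong) (auto simp: transient_def power_add algebra_simps)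
  finally show ?thesis .
qed

lemma transient_tendsto_0: "transient \<longlonglongrightarrow> 0"
proof (rule tendsto_rabs_zero_cancel, rule tendsto_sandwich[where f = "\<lambda>_. 0" and h = "\<lambda>m. C * \<gamma> ^ m"])
  show "(\<lambda>m. C * \<gamma> ^ m) \<longlonglongrightarrow> 0"
    using gamma by (intro tendsto_mult_right_zero LIMSEQ_realpow_zero) auto
qed (auto simp: transient_le)

lemma U_asymptotics: "of_int (U n) = c * \<beta> ^ (n + (d - 1)) + transient (n + (d - 1))"
  by (simp add: U_eq transient_def)

lemma U_0: "U 0 = 1" using w_one by (simp add: U_eq)

text \<open>
Otherwise \<open>U\<close> would be at most the transient, which tends to 0, whereas its values are positive integers.
\<close>
lemma c_pos: "c > 0"
proof (rule ccontr)
  assume "\<not> c > 0"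
  then have "c * \<beta> ^ m \<le> 0" for m using beta by (simp add: mult_nonpos_nonneg)
  then have "of_int (U n) \<le> transient (n + (d - 1))" for n by (simp add: U_asymptotics)
  then have "1 \<le> transient (n + (d - 1))" for n
    using U_pos[of n] by (smt (verit) of_int_1_le_iff)
  moreover have "(\<lambda>n. transient (n + (d - 1))) \<longlonglongrightarrow> 0"
    using transient_tendsto_0 by (rule LIMSEQ_ignore_initial_segment)
  ultimately have "1 \<le> (0::real)" by (intro LIMSEQ_le_const) auto
  then show False by simp
qed

lemma finite_U_le: "finite {l. U l \<le> n}"
proof -
  obtain L where "(of_int n + C) / c < \<beta> ^ L" using real_arch_pow[OF beta] by blast
  then have "of_int n + C < c * \<beta> ^ L" using c_pos by (simp add: pos_divide_less_eq mult.commute)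
  then have L: "of_int n + C < c * \<beta> ^ l" if "l \<ge> L" for l
    using that beta c_pos by (rule_tac less_le_trans) (auto intro!: mult_left_mono power_increasing)
  have "{l. U l \<le> n} \<subseteq> {..<L}"
  proof (rule ccontr)
    assume "\<not> ?thesis"
    then obtain l where l: "U l \<le> n" "l \<ge> L" by (auto simp: subset_iff not_less)
    have "\<bar>transient (l + (d - 1))\<bar> \<le> C"
      using transient_le[of "l + (d - 1)"] C_nonneg gamma mult_left_mono[of "\<gamma> ^ (l + (d - 1))" 1 C]
      by (simp add: power_le_one)
    moreover have "of_int n + C < c * \<beta> ^ (l + (d - 1))" using l by (intro L) auto
    moreover have "real_of_int (U l) \<le> of_int n" using l by simp
    ultimately show False unfolding U_asymptotics by linarith
  qed
  then show ?thesis by (rule finite_subset) simp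
qed

definition defect :: "nat \<Rightarrow> nat \<Rightarrow> real" where
  "defect k i = \<beta> ^ k * of_int (U i) - of_int (U (i + k))"

lemma defect_eq: "defect k i = \<beta> ^ k * transient (i + (d - 1)) - transient (i + (d - 1) + k)"
  unfolding defect_def U_asymptotics by (simp add: power_add algebra_simps)

lemma defect_le: "\<bar>defect k i\<bar> \<le> (\<beta> ^ k + 1) * C * \<gamma> ^ i"
proof -
  have le: "C * \<gamma> ^ (i + j) \<le> C * \<gamma> ^ i" for j
    using gamma C_nonneg by (intro mult_left_mono power_decreasing) auto
  have "\<bar>defect k i\<bar> \<le> \<bar>\<beta> ^ k * transient (i + (d - 1))\<bar> + \<bar>transient (i + (d - 1) + k)\<bar>" unfolding defect_eq by linarith
  also have "\<dots> \<le> \<beta> ^ k * (C * \<gamma> ^ i) + C * \<gamma> ^ i"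
  proof (rule add_mono)
    show "\<bar>\<beta> ^ k * transient (i + (d - 1))\<bar> \<le> \<beta> ^ k * (C * \<gamma> ^ i)"
      using beta order_trans[OF transient_le le] by (simp add: abs_mult mult_left_mono)
    show "\<bar>transient (i + (d - 1) + k)\<bar> \<le> C * \<gamma> ^ i"
      unfolding add.assoc by (rule order_trans[OF transient_le le])
  qed
  finally show ?thesis by (simp add: algebra_simps)
qed

text \<open>
The difference of \<open>U (Suc i)\<close> and \<open>\<beta> U i\<close> is bounded, and \<open>U i\<close> is at least 1.
\<close>
lemma U_ratio: obtains B :: int where "B \<ge> 0" "\<And>i. U (Suc i) \<le> B * U i"
proof -
  define D where "D = (\<beta> + 1) * C"
  have "D \<ge> 0" using beta C_nonneg by (simp add: D_def)
  have "U (Suc i) \<le> \<lceil>\<beta> + D\<rceil> * U i" for i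
  proof -
    have "D * \<gamma> ^ i \<le> D * 1" using gamma \<open>D \<ge> 0\<close> by (intro mult_left_mono power_le_one) auto
    then have "\<bar>defect 1 i\<bar> \<le> D" using defect_le[of 1 i] by (simp add: D_def)
    moreover have "D * 1 \<le> D * of_int (U i)" using U_pos[of i] \<open>D \<ge> 0\<close> by (intro mult_left_mono) auto
    ultimately have "of_int (U (Suc i)) \<le> (\<beta> + D) * of_int (U i)" by (simp add: defect_def algebra_simps)
    also have "\<dots> \<le> of_int \<lceil>\<beta> + D\<rceil> * of_int (U i)"
      using U_pos[of i] by (intro mult_right_mono) auto
    finally show ?thesis by (metis of_int_le_iff of_int_mult)
  qed
  moreover have "\<lceil>\<beta> + D\<rceil> \<ge> 0" using beta \<open>D \<ge> 0\<close> by (simp add: zero_le_ceiling)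
  ultimately show ?thesis using that by blast
qed

lemma bounded_expansions:
  obtains B :: int where "B \<ge> 0"
    "\<And>N. \<exists>e\<in>finite_seqs. seq_value U e = N \<and> seq_ord e = nu U N \<and> (\<forall>i. \<bar>e i\<bar> \<le> B)"
proof -
  obtain B where B: "B \<ge> 0" "\<And>i. U (Suc i) \<le> B * U i" using U_ratio by blast
  have "\<exists>e\<in>finite_seqs. seq_value U e = N \<and> seq_ord e = nu U N \<and> (\<forall>i. \<bar>e i\<bar> \<le> B)" for N
    using bounded_expansion_of_order_nu[OF U_pos U_0 finite_U_le B(2), of N] by metis
  then show ?thesis using that B(1) by blast
qed

section \<open>The coordinates of the map to the torus\<close>

definition \<phi> :: "nat \<Rightarrow> (nat \<Rightarrow> int) \<Rightarrow> real" where
  "\<phi> k g = (\<Sum>i. of_int (g i) * defect k i)"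

lemma bounded_times_decay:
  fixes g :: "nat \<Rightarrow> int" and s :: "nat \<Rightarrow> real"
  assumes "\<And>i. \<bar>g i\<bar> \<le> B" "\<And>i. \<bar>s i\<bar> \<le> D * \<gamma> ^ i"
  shows "summable (\<lambda>i. of_int (g i) * s i)" "\<bar>\<Sum>i. of_int (g i) * s i\<bar> \<le> of_int B * D / (1 - \<gamma>)"
proof -
  have "0 \<le> B" using assms(1)[of 0] by linarith
  have le: "\<bar>of_int (g i) * s i\<bar> \<le> of_int B * D * \<gamma> ^ i" for i
  proof -
    have "real_of_int \<bar>g i\<bar> \<le> of_int B" using assms(1)[of i] by (simp only: of_int_le_iff)
    then have "\<bar>of_int (g i)\<bar> * \<bar>s i\<bar> \<le> of_int B * (D * \<gamma> ^ i)"
      using \<open>0 \<le> B\<close> assms(2)[of i] by (intro mult_mono) auto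
    then show ?thesis by (simp add: abs_mult mult.assoc)
  qed
  have geo: "(\<lambda>i. of_int B * D * \<gamma> ^ i) sums (of_int B * D * (1 / (1 - \<gamma>)))"
    using gamma by (intro sums_mult geometric_sums) auto
  have s: "summable (\<lambda>i. \<bar>of_int (g i) * s i\<bar>)"
    by (rule summable_comparison_test'[OF sums_summable[OF geo]]) (use le in simp)
  show "summable (\<lambda>i. of_int (g i) * s i)" using s by (rule summable_rabs_cancel)
  have "\<bar>\<Sum>i. of_int (g i) * s i\<bar> \<le> (\<Sum>i. \<bar>of_int (g i) * s i\<bar>)" by (rule summable_rabs[OF s])
  also have "\<dots> \<le> of_int B * D * (1 / (1 - \<gamma>))"
    using suminf_le[OF le s sums_summable[OF geo]] sums_unique[OF geo] by simp
  finally show "\<bar>\<Sum>i. of_int (g i) * s i\<bar> \<le> of_int B * D / (1 - \<gamma>)" by simp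
qed

lemma summable_\<phi>:
  assumes "g \<in> carrier bounded_seq_group"
  shows "summable (\<lambda>i. of_int (g i) * defect k i)"
proof -
  obtain B where "\<And>i. \<bar>g i\<bar> \<le> B"
    using assms by (auto simp: carrier_bounded_seq_group elim!: bounded_range_intE)
  then show ?thesis using defect_le by (rule bounded_times_decay)
qed

lemma \<phi>_add:
  assumes "g \<in> carrier bounded_seq_group" "h \<in> carrier bounded_seq_group"
  shows "\<phi> k (\<lambda>i. g i + h i) = \<phi> k g + \<phi> k h"
  unfolding \<phi>_def suminf_add[OF assms[THEN summable_\<phi>]] by (simp add: distrib_right)

lemma \<phi>_diff:
  assumes "g \<in> carrier bounded_seq_group" "h \<in> carrier bounded_seq_group"
  shows "\<phi> k (\<lambda>i. g i - h i) = \<phi> k g - \<phi> k h"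
  unfolding \<phi>_def suminf_diff[OF assms[THEN summable_\<phi>]] by (simp add: left_diff_distrib)

lemma \<phi>_Lipschitz:
  assumes g: "g \<in> carrier bounded_seq_group" and h: "h \<in> carrier bounded_seq_group"
  shows "\<bar>\<phi> k g - \<phi> k h\<bar> \<le> (\<beta> ^ k + 1) * C * seq_dist \<gamma> g h"
proof -
  obtain A where A: "\<And>i. \<bar>g i\<bar> \<le> A"
    using g by (auto simp: carrier_bounded_seq_group elim!: bounded_range_intE)
  obtain B where B: "\<And>i. \<bar>h i\<bar> \<le> B"
    using h by (auto simp: carrier_bounded_seq_group elim!: bounded_range_intE)
  have gh: "\<bar>\<bar>g i - h i\<bar>\<bar> \<le> A + B" for i using A[of i] B[of i] by linarith
  have sd: "summable (\<lambda>i. of_int \<bar>g i - h i\<bar> * \<gamma> ^ i)"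
    using gh by (rule bounded_times_decay(1)[where D = 1]) (use gamma in auto)
  let ?D = "(\<beta> ^ k + 1) * C"
  have sum: "summable (\<lambda>i. ?D * (of_int \<bar>g i - h i\<bar> * \<gamma> ^ i))" using sd by (rule summable_mult)
  have le: "\<bar>of_int (g i - h i) * defect k i\<bar> \<le> ?D * (of_int \<bar>g i - h i\<bar> * \<gamma> ^ i)" for i
  proof -
    have "\<bar>of_int (g i - h i)\<bar> * \<bar>defect k i\<bar> \<le> \<bar>of_int (g i - h i)\<bar> * (?D * \<gamma> ^ i)"
      by (intro mult_left_mono defect_le) auto
    then show ?thesis unfolding abs_mult by (simp only: of_int_abs) (simp only: mult_ac)
  qed
  have s: "summable (\<lambda>i. \<bar>of_int (g i - h i) * defect k i\<bar>)"
    by (rule summable_comparison_test'[OF sum]) (use le in simp)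
  have "\<phi> k g - \<phi> k h = \<phi> k (\<lambda>i. g i - h i)"
    by (simp only: \<phi>_diff[OF g h])
  then have "\<phi> k g - \<phi> k h = (\<Sum>i. of_int (g i - h i) * defect k i)"
    by (simp only: \<phi>_def)
  then have "\<bar>\<phi> k g - \<phi> k h\<bar> \<le> (\<Sum>i. \<bar>of_int (g i - h i) * defect k i\<bar>)" using summable_rabs[OF s] by simp
  also have "\<dots> \<le> (\<Sum>i. ?D * (of_int \<bar>g i - h i\<bar> * \<gamma> ^ i))" by (rule suminf_le[OF le s sum])
  also have "\<dots> = ?D * seq_dist \<gamma> g h"
    using suminf_mult[OF sd, of ?D] g h by (simp add: seq_dist_def)
  finally show ?thesis .
qed

lemma \<phi>_finite:
  assumes "finite A" "\<And>i. i \<notin> A \<Longrightarrow> g i = 0"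
  shows "\<phi> k g = of_int (seq_value U g) * \<beta> ^ k - of_int (\<Sum>i\<in>A. g i * U (i + k))"
proof -
  have "\<phi> k g = (\<Sum>i\<in>A. of_int (g i) * defect k i)"
    unfolding \<phi>_def using assms by (intro suminf_finite) auto
  also have "\<dots> = (\<Sum>i\<in>A. of_int (g i * U i) * \<beta> ^ k - of_int (g i * U (i + k)))"
    by (intro sum.cong) (auto simp: defect_def algebra_simps)
  also have "\<dots> = of_int (\<Sum>i\<in>A. g i * U i) * \<beta> ^ k - of_int (\<Sum>i\<in>A. g i * U (i + k))"
    by (simp only: sum_subtractf sum_distrib_right of_int_sum)
  also have "(\<Sum>i\<in>A. g i * U i) = seq_value U g"
    using assms by (intro seq_value_eq_sum[symmetric])
  finally show ?thesis .
qed

lemma \<phi>_cong_seq_value: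
  assumes "g \<in> finite_seqs"
  obtains z :: int where "\<phi> k g = of_int (seq_value U g) * \<beta> ^ k - of_int z"
proof (rule that)
  show "\<phi> k g = of_int (seq_value U g) * \<beta> ^ k - of_int (\<Sum>i | g i \<noteq> 0. g i * U (i + k))"
    using assms by (intro \<phi>_finite) (auto simp: finite_seqs_def)
qed

lemma \<phi>_small:
  assumes g: "\<And>i. \<bar>g i\<bar> \<le> B" and K: "enat K \<le> seq_ord g"
  shows "\<bar>\<phi> k g\<bar> \<le> of_int B * ((\<beta> ^ k + 1) * C) / (1 - \<gamma>) * \<gamma> ^ K"
proof -
  have "summable (\<lambda>i. of_int (g i) * defect k i)" using g defect_le by (rule bounded_times_decay)
  then have "\<phi> k g = (\<Sum>i. of_int (g (i + K)) * defect k (i + K)) + (\<Sum>i<K. of_int (g i) * defect k i)"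
    unfolding \<phi>_def by (rule suminf_split_initial_segment)
  also have "(\<Sum>i<K. of_int (g i) * defect k i) = 0"
    using K by (intro sum.neutral) (auto simp: enat_le_seq_ord_iff)
  finally have eq: "\<phi> k g = (\<Sum>i. of_int (g (i + K)) * defect k (i + K))" by simp
  have "\<bar>defect k (i + K)\<bar> \<le> (\<beta> ^ k + 1) * C * \<gamma> ^ K * \<gamma> ^ i" for i
    using defect_le[of k "i + K"] by (simp add: power_add mult_ac)
  from bounded_times_decay(2)[of "\<lambda>i. g (i + K)", OF g this] show ?thesis
    by (simp add: eq algebra_simps)
qed

text \<open>
Replace each prefix by a bounded expansion of the same value. This changes \<open>\<phi> k\<close> by an integer, and
the new expansions have orders tending to infinity, so that their \<open>\<phi> k\<close> tends to 0.
\<close>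
lemma \<phi>_null_seqs:
  assumes g: "g \<in> null_seqs U"
  shows "\<phi> k g \<in> \<int>"
proof -
  have gc: "g \<in> carrier bounded_seq_group"
    and lim: "\<forall>K. \<forall>\<^sub>F n in sequentially. enat K \<le> nu_seq U (seq_prefix n g)"
    using g by (auto simp: null_seqs_def tendsto_enat_infinity_iff)
  obtain B where B: "B \<ge> 0"
    "\<And>N. \<exists>e\<in>finite_seqs. seq_value U e = N \<and> seq_ord e = nu U N \<and> (\<forall>i. \<bar>e i\<bar> \<le> B)"
    using bounded_expansions by metis
  define p where "p n = seq_prefix n g" for n
  have "\<forall>n. \<exists>e\<in>finite_seqs. seq_value U e = seq_value U (p n) \<and>
      seq_ord e = nu U (seq_value U (p n)) \<and> (\<forall>i. \<bar>e i\<bar> \<le> B)" using B(2) by blast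
  then obtain e where e: "\<And>n. e n \<in> finite_seqs" "\<And>n. seq_value U (e n) = seq_value U (p n)"
    "\<And>n. seq_ord (e n) = nu_seq U (p n)" "\<And>n i. \<bar>e n i\<bar> \<le> B"
    unfolding nu_seq_def by metis
  have "(\<lambda>n. \<phi> k (p n)) \<longlonglongrightarrow> \<phi> k g"
  proof -
    have "\<phi> k (p n) = (\<Sum>i<n. of_int (g i) * defect k i)" for n
    proof -
      have "\<phi> k (p n) = (\<Sum>i<n. of_int (p n i) * defect k i)"
        unfolding \<phi>_def by (intro suminf_finite) (auto simp: p_def seq_prefix_def)
      also have "\<dots> = (\<Sum>i<n. of_int (g i) * defect k i)"
        by (intro sum.cong) (auto simp: p_def seq_prefix_def)
      finally show ?thesis .
    qed
    then show ?thesis using summable_LIMSEQ[OF summable_\<phi>[OF gc, of k]] by (simp add: \<phi>_def)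
  qed
  moreover have "(\<lambda>n. \<phi> k (e n)) \<longlonglongrightarrow> 0"
  proof (rule LIMSEQ_I)
    fix \<epsilon> :: real assume "\<epsilon> > 0"
    define M where "M = of_int B * ((\<beta> ^ k + 1) * C) / (1 - \<gamma>)"
    have "(\<lambda>K. M * \<gamma> ^ K) \<longlonglongrightarrow> 0"
      using gamma by (intro tendsto_mult_right_zero LIMSEQ_realpow_zero) auto
    from order_tendstoD(2)[OF this \<open>\<epsilon> > 0\<close>] obtain K where K: "M * \<gamma> ^ K < \<epsilon>"
      by (auto simp: eventually_sequentially)
    obtain n0 where "\<And>n. n \<ge> n0 \<Longrightarrow> enat K \<le> nu_seq U (p n)"
      using lim unfolding p_def eventually_sequentially by blast
    then have "\<bar>\<phi> k (e n)\<bar> < \<epsilon>" if "n \<ge> n0" for n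
      using \<phi>_small[of "e n" B K k, OF e(4)] that K by (simp add: e(3) M_def)
    then show "\<exists>n0. \<forall>n\<ge>n0. norm (\<phi> k (e n) - 0) < \<epsilon>" by auto
  qed
  ultimately have "(\<lambda>n. \<phi> k (p n) - \<phi> k (e n)) \<longlonglongrightarrow> \<phi> k g - 0" by (rule tendsto_diff)
  moreover have "\<phi> k (p n) - \<phi> k (e n) \<in> \<int>" for n
  proof -
    have "p n \<in> finite_seqs" by (simp add: p_def seq_prefix_finite)
    then obtain z z' :: int where "\<phi> k (p n) = of_int (seq_value U (p n)) * \<beta> ^ k - of_int z"
      "\<phi> k (e n) = of_int (seq_value U (e n)) * \<beta> ^ k - of_int z'"
      using \<phi>_cong_seq_value e(1) by metis
    then have "\<phi> k (p n) - \<phi> k (e n) = of_int (z' - z)" by (simp add: e(2))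
    then show ?thesis by simp
  qed
  ultimately show ?thesis using closed_sequentially[OF closed_Ints] by force
qed

section \<open>The null sequences form a subgroup\<close>

text \<open>
Add bounded expansions digit by digit; preservation of zeros limits the loss caused by normalising
the result.
\<close>
lemma nu_add:
  assumes "preserves_zeros U"
  obtains K where "\<And>k M N. enat k \<le> nu U M \<Longrightarrow> enat k \<le> nu U N \<Longrightarrow> enat k \<le> nu U (M + N) + enat K"
proof -
  obtain B where B: "B \<ge> 0"
    "\<And>N. \<exists>e\<in>finite_seqs. seq_value U e = N \<and> seq_ord e = nu U N \<and> (\<forall>i. \<bar>e i\<bar> \<le> B)"
    using bounded_expansions by metis
  obtain K where K: "\<And>g. g \<in> finite_seqs \<Longrightarrow> (\<forall>n. \<bar>g n\<bar> \<le> int (nat (2 * B))) \<Longrightarrow>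
      seq_ord g \<le> nu_seq U g + enat K"
    using assms unfolding preserves_zeros_def by blast
  have "enat k \<le> nu U (M + N) + enat K" if k: "enat k \<le> nu U M" "enat k \<le> nu U N" for k M N
  proof -
    obtain e where e: "e \<in> finite_seqs" "seq_value U e = M" "seq_ord e = nu U M" "\<And>i. \<bar>e i\<bar> \<le> B"
      using B(2) by metis
    obtain f where f: "f \<in> finite_seqs" "seq_value U f = N" "seq_ord f = nu U N" "\<And>i. \<bar>f i\<bar> \<le> B"
      using B(2) by metis
    have "enat k \<le> seq_ord (\<lambda>i. e i + f i)"
      using k unfolding e(3)[symmetric] f(3)[symmetric] enat_le_seq_ord_iff by simp
    also have "\<dots> \<le> nu_seq U (\<lambda>i. e i + f i) + enat K"
    proof (rule K[OF finite_seqs_add[OF e(1) f(1)]], intro allI)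
      fix n show "\<bar>e n + f n\<bar> \<le> int (nat (2 * B))" using e(4)[of n] f(4)[of n] B(1) by simp
    qed
    finally show ?thesis by (simp add: nu_seq_def seq_value_add e f)
  qed
  then show ?thesis using that by blast
qed

lemma nu_0: "nu U 0 = \<infinity>"
proof -
  have "greedy U \<bar>0\<bar> \<in> expansions U \<bar>0\<bar>" by (rule greedy_expansion[OF U_pos U_0 finite_U_le]) simp
  then have g: "finite {i. greedy U 0 i \<noteq> 0}" "\<And>i. greedy U 0 i \<ge> 0" "(\<Sum>i | greedy U 0 i \<noteq> 0. greedy U 0 i * U i) = 0"
    by (auto simp: expansions_def finite_seqs_def seq_value_def)
  have "greedy U 0 i = 0" for i
  proof (rule ccontr)
    assume i: "greedy U 0 i \<noteq> 0"
    then have "greedy U 0 i * U i = 0"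
      using g U_pos by (subst (asm) sum_nonneg_eq_0_iff) (auto intro: mult_nonneg_nonneg less_imp_le)
    then show False using i U_pos[of i] by simp
  qed
  then show ?thesis by (simp add: nu_def seq_ord_def top_enat_def)
qed

lemma subgroup_null_seqs:
  assumes "preserves_zeros U"
  shows "subgroup (null_seqs U) bounded_seq_group"
proof -
  interpret comm_group bounded_seq_group by (rule comm_group_bounded_seq_group)
  obtain K where K: "\<And>k M N. enat k \<le> nu U M \<Longrightarrow> enat k \<le> nu U N \<Longrightarrow> enat k \<le> nu U (M + N) + enat K"
    using nu_add[OF assms] by blast
  show ?thesis
  proof (rule subgroupI)
    show "null_seqs U \<subseteq> carrier bounded_seq_group" by (auto simp: null_seqs_def)
    have "(\<lambda>_. 0) \<in> null_seqs U"
      by (simp add: null_seqs_def nu_seq_def seq_value_seq_prefix nu_0)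
        (simp add: bounded_seq_group_def)
    then show "null_seqs U \<noteq> {}" by blast
    fix g assume g: "g \<in> null_seqs U"
    then have gc: "g \<in> carrier bounded_seq_group" by (simp add: null_seqs_def)
    have "nu_seq U (seq_prefix n (\<lambda>i. - g i)) = nu_seq U (seq_prefix n g)" for n
      by (simp add: nu_seq_def seq_value_seq_prefix sum_negf nu_minus)
    then show "inv\<^bsub>bounded_seq_group\<^esub> g \<in> null_seqs U"
      using g inv_closed[OF gc] unfolding inv_bounded_seq_group[OF gc] by (simp add: null_seqs_def)
    fix h assume h: "h \<in> null_seqs U"
    have "\<forall>\<^sub>F n in sequentially. enat k \<le> nu_seq U (seq_prefix n (\<lambda>i. g i + h i))" for k
    proof -
      have "\<forall>\<^sub>F n in sequentially. enat (k + K) \<le> nu_seq U (seq_prefix n g)"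
        "\<forall>\<^sub>F n in sequentially. enat (k + K) \<le> nu_seq U (seq_prefix n h)"
        using g h by (simp_all add: null_seqs_def tendsto_enat_infinity_iff)
      then show ?thesis
      proof eventually_elim
        case (elim n)
        from K[OF elim[unfolded nu_seq_def]]
        have "enat (k + K) \<le> nu_seq U (seq_prefix n (\<lambda>i. g i + h i)) + enat K"
          by (simp add: nu_seq_def seq_value_seq_prefix sum.distrib distrib_right)
        then show ?case by (cases "nu_seq U (seq_prefix n (\<lambda>i. g i + h i))") auto
      qed
    qed
    moreover have "h \<in> carrier bounded_seq_group" using h by (simp add: null_seqs_def)
    then have "(\<lambda>i. g i + h i) \<in> carrier bounded_seq_group"
      using m_closed[OF gc] by (simp add: bounded_seq_group_def)
    ultimately show "g \<otimes>\<^bsub>bounded_seq_group\<^esub> h \<in> null_seqs U"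
      by (simp add: null_seqs_def tendsto_enat_infinity_iff) (simp add: bounded_seq_group_def)
  qed
qed

section \<open>Unimodular recurrences\<close>

definition recurrent :: "(nat \<Rightarrow> 'a::comm_ring_1) \<Rightarrow> bool" where
  "recurrent x \<longleftrightarrow> (\<forall>m. x (m + d) = (\<Sum>i<d. of_int (a i) * x (m + i)))"

lemma recurrent_eqI:
  assumes "recurrent x" "recurrent y" "\<And>k. k < d \<Longrightarrow> x k = y k"
  shows "x m = y m"
proof (rule linear_recurrence_unique[where a = "\<lambda>i. of_int (a i)" and d = d])
qed (use assms in \<open>auto simp: recurrent_def\<close>)

lemma recurrent_shift: "recurrent x \<Longrightarrow> recurrent (\<lambda>k. x (s + k))"
  by (simp add: recurrent_def flip: add.assoc)

lemma recurrent_sum: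
  assumes "\<And>i. i \<in> A \<Longrightarrow> recurrent (x i)"
  shows "recurrent (\<lambda>k. \<Sum>i\<in>A. e i * x i k)"
  unfolding recurrent_def
proof
  fix m
  have "(\<Sum>j<d. of_int (a j) * (\<Sum>i\<in>A. e i * x i (m + j))) = (\<Sum>i\<in>A. \<Sum>j<d. of_int (a j) * (e i * x i (m + j)))"
    unfolding sum_distrib_left by (rule sum.swap)
  also have "\<dots> = (\<Sum>i\<in>A. e i * x i (m + d))"
  proof (rule sum.cong)
    fix i assume "i \<in> A"
    have "(\<Sum>j<d. of_int (a j) * (e i * x i (m + j))) = e i * (\<Sum>j<d. of_int (a j) * x i (m + j))"
      by (simp add: sum_distrib_left mult.left_commute)
    then show "(\<Sum>j<d. of_int (a j) * (e i * x i (m + j))) = e i * x i (m + d)"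
      using assms[OF \<open>i \<in> A\<close>] by (simp add: recurrent_def)
  qed simp
  finally show "(\<Sum>i\<in>A. e i * x i (m + d)) = (\<Sum>j<d. of_int (a j) * (\<Sum>i\<in>A. e i * x i (m + j)))" ..
qed

lemma recurrent_suminf:
  fixes x :: "nat \<Rightarrow> nat \<Rightarrow> real"
  assumes rec: "\<And>i. recurrent (x i)" and sm: "\<And>k. summable (\<lambda>i. e i * x i k)"
  shows "recurrent (\<lambda>k. \<Sum>i. e i * x i k)"
  unfolding recurrent_def
proof
  fix m
  have "(\<Sum>j<d. of_int (a j) * (\<Sum>i. e i * x i (m + j))) = (\<Sum>j<d. \<Sum>i. of_int (a j) * (e i * x i (m + j)))"
    by (intro sum.cong suminf_mult[symmetric] sm) simp
  also have "\<dots> = (\<Sum>i. \<Sum>j<d. of_int (a j) * (e i * x i (m + j)))"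
    by (intro suminf_sum[symmetric] summable_mult sm)
  also have "\<dots> = (\<Sum>i. e i * x i (m + d))"
  proof (rule suminf_cong)
    fix i
    have "(\<Sum>j<d. of_int (a j) * (e i * x i (m + j))) = e i * (\<Sum>j<d. of_int (a j) * x i (m + j))"
      by (simp add: sum_distrib_left mult.left_commute)
    then show "(\<Sum>j<d. of_int (a j) * (e i * x i (m + j))) = e i * x i (m + d)"
      using rec[of i] by (simp add: recurrent_def)
  qed
  finally show "(\<Sum>i. e i * x i (m + d)) = (\<Sum>j<d. of_int (a j) * (\<Sum>i. e i * x i (m + j)))" ..
qed

lemma recurrent_w: "recurrent w"
  by (simp add: recurrent_def w_rec)

lemma recurrent_transient: "recurrent transient"
  by (simp add: recurrent_def transient_rec)

lemma recurrent_power: "recurrent (\<lambda>k. \<beta> ^ k)"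
  by (simp add: recurrent_def power_add beta_rec sum_distrib_left algebra_simps)

text \<open>
The shifts \<open>\<lambda>k. w (i + k)\<close> with \<open>i < d\<close> form a basis of the integral solutions of the recurrence: the matrix
of the numbers \<open>w (i + k)\<close> for \<open>i, k < d\<close> is 1 on the antidiagonal \<open>i + k = d - 1\<close> and 0 on one side of it.
Solving this triangular system also bounds the coordinates in terms of the initial values.
\<close>
lemma bounded_impulse_combination:
  fixes B :: int
  obtains F :: int where "\<And>x. (\<And>k. k < d \<Longrightarrow> \<bar>x k\<bar> \<le> B) \<Longrightarrow> recurrent x \<Longrightarrow>
    \<exists>h. (\<forall>i. \<bar>h i\<bar> \<le> F) \<and> (\<forall>k. x k = (\<Sum>i<d. h i * w (i + k)))"
proof -
  have "\<exists>F\<ge>0. \<forall>x. (\<forall>k<d. \<bar>x k\<bar> \<le> B) \<longrightarrow>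
    (\<exists>h. (\<forall>i. \<bar>h i\<bar> \<le> F) \<and> (\<forall>i<d-t. h i = 0) \<and> (\<forall>k<t. x k = (\<Sum>i<d. h i * w (i + k))))"
    if "t \<le> d" for t
    using that
  proof (induction t)
    case 0
    show ?case by (intro exI[of _ 0] conjI allI impI) (auto intro!: exI[of _ "\<lambda>_. 0"])
  next
    case (Suc t)
    then obtain F where F: "F \<ge> 0" "\<And>x. (\<forall>k<d. \<bar>x k\<bar> \<le> B) \<Longrightarrow>
      \<exists>h. (\<forall>i. \<bar>h i\<bar> \<le> F) \<and> (\<forall>i<d-t. h i = 0) \<and> (\<forall>k<t. x k = (\<Sum>i<d. h i * w (i + k)))"
      by force
    define F' where "F' = F + \<bar>B\<bar> + (\<Sum>i<d. F * \<bar>w (i + t)\<bar>)"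
    have S0: "(\<Sum>i<d. F * \<bar>w (i + t)\<bar>) \<ge> 0" using F(1) by (intro sum_nonneg) auto
    have "\<exists>h. (\<forall>i. \<bar>h i\<bar> \<le> F') \<and> (\<forall>i<d-Suc t. h i = 0) \<and> (\<forall>k<Suc t. x k = (\<Sum>i<d. h i * w (i + k)))"
      if x: "\<forall>k<d. \<bar>x k\<bar> \<le> B" for x
    proof -
      obtain h where h: "\<And>i. \<bar>h i\<bar> \<le> F" "\<And>i. i < d - t \<Longrightarrow> h i = 0"
        "\<And>k. k < t \<Longrightarrow> x k = (\<Sum>i<d. h i * w (i + k))" using F(2)[OF x] by blast
      \<comment> \<open>The shift of \<open>w\<close> by \<open>p\<close> vanishes before the index \<open>t\<close> and is 1 there, so it corrects the value
        at \<open>t\<close> and leaves the earlier ones unchanged.\<close>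
      define p where "p = d - Suc t"
      have p: "p < d" "p < d - t" "p + t = d - 1" using Suc.prems by (auto simp: p_def)
      define \<delta> where "\<delta> = x t - (\<Sum>i<d. h i * w (i + t))"
      define h' where "h' = h(p := \<delta>)"
      have sum: "(\<Sum>i<d. h' i * w (i + k)) = (\<Sum>i<d. h i * w (i + k)) + \<delta> * w (p + k)" for k
      proof -
        have "(\<Sum>i<d. h' i * w (i + k)) = (\<Sum>i<d. h i * w (i + k) + (if i = p then \<delta> * w (p + k) else 0))"
          using h(2)[OF p(2)] by (intro sum.cong) (auto simp: h'_def)
        then show ?thesis using p by (simp add: sum.distrib)
      qed
      have "\<bar>\<Sum>i<d. h i * w (i + t)\<bar> \<le> (\<Sum>i<d. F * \<bar>w (i + t)\<bar>)"
        using h(1) by (intro order_trans[OF sum_abs] sum_mono) (simp add: abs_mult mult_right_mono)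
      moreover have "\<bar>x t\<bar> \<le> B" using x Suc.prems by simp
      ultimately have "\<bar>\<delta>\<bar> \<le> F'" unfolding \<delta>_def F'_def using F(1) by linarith
      moreover have "\<bar>h i\<bar> \<le> F'" for i using h(1)[of i] S0 unfolding F'_def by linarith
      ultimately have "\<forall>i. \<bar>h' i\<bar> \<le> F'" by (simp add: h'_def)
      moreover have "\<forall>i<d-Suc t. h' i = 0" using h(2) p by (auto simp: h'_def p_def)
      moreover have "x k = (\<Sum>i<d. h' i * w (i + k))" if "k < Suc t" for k
      proof (cases "k = t")
        case True
        then show ?thesis using p w_one by (simp add: sum \<delta>_def)
      next
        case False
        then have "k < t" using that by simp
        then have "w (p + k) = 0" using p by (intro w_zero) simp
        then show ?thesis using h(3)[OF \<open>k < t\<close>] by (simp add: sum)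
      qed
      ultimately show ?thesis by blast
    qed
    moreover have "F' \<ge> 0" using F(1) S0 by (simp add: F'_def)
    ultimately show ?case by blast
  qed
  from this[of d] obtain F where F: "\<And>x. (\<forall>k<d. \<bar>x k\<bar> \<le> B) \<Longrightarrow>
    (\<exists>h. (\<forall>i. \<bar>h i\<bar> \<le> F) \<and> (\<forall>k<d. x k = (\<Sum>i<d. h i * w (i + k))))" by auto
  have "\<exists>h. (\<forall>i. \<bar>h i\<bar> \<le> F) \<and> (\<forall>k. x k = (\<Sum>i<d. h i * w (i + k)))"
    if x: "\<And>k. k < d \<Longrightarrow> \<bar>x k\<bar> \<le> B" and rec: "recurrent x" for x
  proof -
    obtain h where h: "\<forall>i. \<bar>h i\<bar> \<le> F" "\<And>k. k < d \<Longrightarrow> x k = (\<Sum>i<d. h i * w (i + k))"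
      using F[of x] x by blast
    have "recurrent (\<lambda>k. \<Sum>i<d. h i * w (i + k))"
      by (intro recurrent_sum recurrent_shift recurrent_w)
    from recurrent_eqI[OF rec this h(2)] show ?thesis using h(1) by blast
  qed
  then show ?thesis using that by blast
qed

lemma recurrent_extension:
  fixes x0 :: "nat \<Rightarrow> int"
  obtains x :: "nat \<Rightarrow> int" where "recurrent x" "\<And>k. k < d \<Longrightarrow> x k = x0 k"
proof -
  \<comment> \<open>The list \<open>x n\<close> collects the first \<open>n\<close> values.\<close>
  define x where "x = rec_nat [] (\<lambda>n xs. xs @ [if n < d then x0 n else \<Sum>i<d. a i * (xs ! (n - d + i))])"
  have [simp]: "length (x n) = n" for n by (induction n) (auto simp: x_def)
  have Suc: "x (Suc n) = x n @ [if n < d then x0 n else \<Sum>i<d. a i * (x n ! (n - d + i))]" for n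
    by (simp add: x_def)
  define y where "y n = x (Suc n) ! n" for n
  have nth: "x n ! i = y i" if "i < n" for i n
    using that by (induction n) (auto simp: Suc nth_append y_def less_Suc_eq)
  have y: "y n = (if n < d then x0 n else \<Sum>i<d. a i * (x n ! (n - d + i)))" for n
    by (simp add: y_def Suc nth_append)
  show ?thesis
  proof
    show "y k = x0 k" if "k < d" for k using that by (simp add: y)
    have "y (m + d) = (\<Sum>i<d. a i * y (m + i))" for m
      by (subst y) (auto intro!: sum.cong simp: nth)
    then show "recurrent y" by (simp add: recurrent_def)
  qed
qed

text \<open>
Running the recurrence one step backwards divides by \<open>a 0\<close>, which is a unit of the integers.
\<close>
lemma recurrent_backward:
  assumes unit: "\<bar>a 0\<bar> = 1" and x: "recurrent (x :: nat \<Rightarrow> int)"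
  shows "\<exists>y. recurrent y \<and> (\<forall>k. y (s + k) = x k)"
proof (induction s)
  case 0
  then show ?case using x by auto
next
  case (Suc s)
  then obtain y where y: "recurrent y" "\<And>k. y (s + k) = x k" by blast
  define y0 where "y0 = a 0 * (y (d - 1) - (\<Sum>i\<in>{1..<d}. a i * y (i - 1)))"
  define z where "z k = (case k of 0 \<Rightarrow> y0 | Suc k \<Rightarrow> y k)" for k
  have sq: "a 0 * a 0 = 1" using unit by (auto simp: abs_if split: if_splits)
  have "z (m + d) = (\<Sum>i<d. a i * z (m + i))" for m
  proof (cases m)
    case 0
    have "(\<Sum>i<d. a i * z i) = a 0 * y0 + (\<Sum>i\<in>{1..<d}. a i * z i)"
      using d_pos by (simp add: lessThan_atLeast0 sum.atLeast_Suc_lessThan z_def)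
    also have "(\<Sum>i\<in>{1..<d}. a i * z i) = (\<Sum>i\<in>{1..<d}. a i * y (i - 1))"
      by (intro sum.cong) (auto simp: z_def split: nat.splits)
    also have "a 0 * y0 = y (d - 1) - (\<Sum>i\<in>{1..<d}. a i * y (i - 1))"
      unfolding y0_def mult.assoc[symmetric] sq by simp
    finally show ?thesis using d_pos by (simp add: 0 z_def split: nat.splits)
  next
    case (Suc n)
    then show ?thesis using y(1) by (simp add: z_def recurrent_def)
  qed
  then have "recurrent z" by (simp add: recurrent_def)
  moreover have "z (Suc s + k) = x k" for k using y(2) by (simp add: z_def)
  ultimately show ?case by blast
qed

text \<open>
Running the recurrence one step backwards divides by \<open>a 0\<close>, which is a unit of the integers.
\<close>
lemma recurrent_backward_unique:
  assumes a0: "a 0 \<noteq> 0" and x: "recurrent (x :: nat \<Rightarrow> real)" and y: "recurrent y"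
    and eq: "\<And>k. x (s + k) = y (s + k)"
  shows "x k = y k"
proof -
  have "\<forall>k. x (s + k) = y (s + k)" using eq by blast
  then have "\<forall>k. x (0 + k) = y (0 + k)"
  proof (induction s)
    case (Suc s)
    have ge: "x (s + k) = y (s + k)" if "k > 0" for k
      using Suc.prems that by (metis Suc_pred add_Suc_shift)
    have "of_int (a 0) * x s = x (s + d) - (\<Sum>i\<in>{1..<d}. of_int (a i) * x (s + i))"
      "of_int (a 0) * y s = y (s + d) - (\<Sum>i\<in>{1..<d}. of_int (a i) * y (s + i))"
      using x y d_pos unfolding recurrent_def
      by (simp_all add: lessThan_atLeast0 sum.atLeast_Suc_lessThan)
    moreover have "(\<Sum>i\<in>{1..<d}. of_int (a i) * x (s + i)) = (\<Sum>i\<in>{1..<d}. of_int (a i) * y (s + i))"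
      by (intro sum.cong) (auto simp: ge)
    ultimately have "of_int (a 0) * x s = of_int (a 0) * y s" using ge[OF d_pos] by (simp only:)
    then have "x s = y s" using a0 by simp
    then have "\<forall>k. x (s + k) = y (s + k)" using ge by (metis add.right_neutral gr0I)
    then show ?case by (rule Suc.IH)
  qed simp
  then show ?thesis by simp
qed

text \<open>
Continuing \<open>x0\<close> to a recurrent sequence and then backwards by \<open>d - 1\<close> steps turns shifts of \<open>w\<close> into
shifts of \<open>U\<close>.
\<close>
lemma unimodular_combination:
  assumes unit: "\<bar>a 0\<bar> = 1"
  obtains h where "\<And>k. k < d \<Longrightarrow> x0 k = (\<Sum>i<d. h i * U (i + k))"
proof -
  obtain x where x: "recurrent x" "\<And>k. k < d \<Longrightarrow> x k = x0 k" using recurrent_extension by blast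
  then obtain y where y: "recurrent y" "\<And>k. y (d - 1 + k) = x k"
    using recurrent_backward[OF unit] by metis
  define B where "B = Max ((\<lambda>k. \<bar>y k\<bar>) ` {..<d})"
  have "\<And>k. k < d \<Longrightarrow> \<bar>y k\<bar> \<le> B" by (auto simp: B_def)
  then obtain h where h: "\<And>k. y k = (\<Sum>i<d. h i * w (i + k))"
    using bounded_impulse_combination[of B] y(1) by metis
  have "x0 k = (\<Sum>i<d. h i * U (i + k))" if "k < d" for k
    unfolding x(2)[OF that, symmetric] y(2)[symmetric] h U_eq by (intro sum.cong) (auto simp: ac_simps)
  then show ?thesis using that by blast
qed

lemma transient_shift_le: "\<bar>transient (i + k)\<bar> \<le> C * \<gamma> ^ i"
  using gamma C_nonneg by (intro order_trans[OF transient_le] mult_left_mono power_decreasing) auto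

text \<open>
The sums form a recurrent sequence \<open>\<sigma>\<close> of the index \<open>k\<close>. The condition \<open>\<phi> k g = 0\<close> reads \<open>\<sigma> k = \<beta>\<^sup>k \<sigma> 0\<close>, which
the recurrence extends from \<open>k < d\<close> to all \<open>k\<close>. So \<open>\<sigma>\<close> is geometric of ratio \<open>\<beta> > 1\<close>; but it is also bounded.
\<close>
lemma contracting_part_vanishes:
  assumes g: "\<And>i. \<bar>g i\<bar> \<le> B" and z: "\<And>k. k < d \<Longrightarrow> \<phi> k g = 0"
  shows "(\<Sum>i. of_int (g i) * transient (i + (d - 1) + k)) = 0"
proof -
  define \<sigma> where "\<sigma> k = (\<Sum>i. of_int (g i) * transient (i + (d - 1) + k))" for k
  have rle: "\<bar>transient (i + (d - 1) + k)\<bar> \<le> C * \<gamma> ^ i" for i k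
    unfolding add.assoc by (rule transient_shift_le)
  have sm: "summable (\<lambda>i. of_int (g i) * transient (i + (d - 1) + k))" for k
    using g rle by (rule bounded_times_decay)
  have \<sigma>_le: "\<bar>\<sigma> k\<bar> \<le> of_int B * C / (1 - \<gamma>)" for k
    unfolding \<sigma>_def using g rle by (rule bounded_times_decay)
  have "recurrent \<sigma>"
    unfolding \<sigma>_def by (intro recurrent_suminf recurrent_shift recurrent_transient sm)
  moreover have "recurrent (\<lambda>k. \<beta> ^ k * \<sigma> 0)"
    using recurrent_sum[of "{()}" "\<lambda>_ k. \<beta> ^ k" "\<lambda>_. \<sigma> 0"] recurrent_power by (simp add: mult.commute)
  moreover have "\<sigma> k = \<beta> ^ k * \<sigma> 0" if "k < d" for k
  proof -
    have "(\<lambda>i. of_int (g i) * defect k i) sums (\<beta> ^ k * \<sigma> 0 - \<sigma> k)"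
    proof -
      have "(\<lambda>i. \<beta> ^ k * (of_int (g i) * transient (i + (d - 1) + 0)) - of_int (g i) * transient (i + (d - 1) + k)) sums (\<beta> ^ k * \<sigma> 0 - \<sigma> k)"
        unfolding \<sigma>_def by (intro sums_diff sums_mult summable_sums sm)
      then show ?thesis by (simp add: defect_eq algebra_simps)
    qed
    then have "\<phi> k g = \<beta> ^ k * \<sigma> 0 - \<sigma> k" unfolding \<phi>_def by (rule sums_unique[symmetric])
    then show ?thesis using z[OF that] by simp
  qed
  ultimately have pw: "\<sigma> k = \<beta> ^ k * \<sigma> 0" for k by (rule recurrent_eqI)
  have "\<sigma> 0 = 0"
  proof (rule ccontr)
    assume ne: "\<sigma> 0 \<noteq> 0"
    obtain k where "of_int B * C / (1 - \<gamma>) / \<bar>\<sigma> 0\<bar> < \<beta> ^ k" using real_arch_pow[OF beta] by blast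
    then have "of_int B * C / (1 - \<gamma>) < \<beta> ^ k * \<bar>\<sigma> 0\<bar>"
      using ne by (subst (asm) pos_divide_less_eq) auto
    also have "\<dots> = \<bar>\<beta> ^ k * \<sigma> 0\<bar>" using beta by (simp add: abs_mult)
    finally have "of_int B * C / (1 - \<gamma>) < \<bar>\<beta> ^ k * \<sigma> 0\<bar>" .
    then show False using \<sigma>_le[of k] unfolding pw[of k] by simp
  qed
  then show ?thesis using pw[of k] by (simp add: \<sigma>_def)
qed

text \<open>
The value of a prefix of length \<open>n\<close> can be written with \<open>d\<close> digits at the positions \<open>n, \<dots>, n + d - 1\<close>,
bounded independently of \<open>n\<close>. The digits are the coordinates, with respect to the shifts of \<open>w\<close>, of
the sequence \<open>\<Sum>\<^bsub>i<n\<^esub> g\<^sub>i w (i + d - 1 + k)\<close> in \<open>k\<close>, continued backwards by \<open>n + d - 1\<close> steps. The expanding part of this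
continuation is bounded as a geometric sum. Its contracting part could explode backwards, but as
\<open>\<Sum>\<^sub>i g\<^sub>i transient (i + d - 1 + k) = 0\<close> it equals minus the contribution of the digits from \<open>n\<close> on, which is
bounded as well.
\<close>
lemma unimodular_tail_digits:
  assumes unit: "\<bar>a 0\<bar> = 1" and g: "\<And>i. \<bar>g i\<bar> \<le> B" and z: "\<And>k. k < d \<Longrightarrow> \<phi> k g = 0"
  obtains F where "\<And>n. \<exists>h. (\<forall>i. \<bar>h i\<bar> \<le> F) \<and> (\<Sum>i<n. g i * U i) = (\<Sum>i<d. h i * U (n + i))"
proof -
  \<comment> \<open>The two summands bound the expanding and the contracting part of the continuation \<open>Y\<close> below.\<close>
  define M where "M = \<bar>c\<bar> * of_int B * \<beta> ^ d / (\<beta> - 1) + of_int B * C / (1 - \<gamma>)"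
  obtain F where F: "\<And>x. (\<And>k. k < d \<Longrightarrow> \<bar>x k\<bar> \<le> \<lceil>M\<rceil>) \<Longrightarrow> recurrent x \<Longrightarrow>
    \<exists>h. (\<forall>i. \<bar>h i\<bar> \<le> F) \<and> (\<forall>k. x k = (\<Sum>i<d. h i * w (i + k)))"
    using bounded_impulse_combination[of "\<lceil>M\<rceil>"] by blast
  have "B \<ge> 0" using g[of 0] by linarith
  have "\<exists>h. (\<forall>i. \<bar>h i\<bar> \<le> F) \<and> (\<Sum>i<n. g i * U i) = (\<Sum>i<d. h i * U (n + i))" for n
  proof -
    define x where "x k = (\<Sum>i<n. g i * w (i + (d - 1) + k))" for k
    have "recurrent x"
      unfolding x_def by (intro recurrent_sum recurrent_shift recurrent_w)
    then obtain y where y: "recurrent y" "\<And>k. y (n + (d - 1) + k) = x k"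
      using recurrent_backward[OF unit] by metis
    define H where "H = (\<Sum>i<n. of_int (g i) * \<beta> ^ i)"
    define T where "T k = (\<Sum>i. of_int (g (i + n)) * transient (i + k))" for k
    \<comment> \<open>\<open>Y\<close> is an explicit real formula for the integral continuation \<open>y\<close>.\<close>
    define Y where "Y k = c * H / \<beta> ^ n * \<beta> ^ k - T k" for k
    have "recurrent T"
      unfolding T_def using g transient_shift_le by (intro recurrent_suminf recurrent_shift recurrent_transient bounded_times_decay(1))
    then have "recurrent Y"
      using recurrent_power unfolding recurrent_def Y_def
      by (simp add: right_diff_distrib sum_subtractf sum_distrib_left mult_ac)
    have Yx: "Y (n + (d - 1) + k) = of_int (x k)" for k
    proof -
      have rle: "\<bar>transient (i + (d - 1) + k)\<bar> \<le> C * \<gamma> ^ i" for i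
        unfolding add.assoc by (rule transient_shift_le)
      have "(\<Sum>i. of_int (g i) * transient (i + (d - 1) + k)) = (\<Sum>i. of_int (g (i + n)) * transient (i + n + (d - 1) + k)) + (\<Sum>i<n. of_int (g i) * transient (i + (d - 1) + k))"
        by (intro suminf_split_initial_segment bounded_times_decay(1)[OF g rle])
      then have T: "T (n + (d - 1) + k) = - (\<Sum>i<n. of_int (g i) * transient (i + (d - 1) + k))"
        using contracting_part_vanishes[OF g z, of k] by (simp add: T_def add.assoc)
      have "c * H / \<beta> ^ n * \<beta> ^ (n + (d - 1) + k) = (\<Sum>i<n. of_int (g i) * (c * \<beta> ^ (i + (d - 1) + k)))"
        unfolding H_def sum_distrib_left sum_distrib_right sum_divide_distrib
        using beta by (intro sum.cong) (auto simp: power_add)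
      then have "Y (n + (d - 1) + k) = (\<Sum>i<n. of_int (g i) * (c * \<beta> ^ (i + (d - 1) + k) + transient (i + (d - 1) + k)))"
        unfolding Y_def T by (simp add: sum.distrib distrib_left)
      then show ?thesis by (simp add: transient_def x_def)
    qed
    have recy: "recurrent (\<lambda>k. real_of_int (y k))"
      using y(1) by (simp add: recurrent_def)
    have yY: "real_of_int (y k) = Y k" for k
    proof (rule recurrent_backward_unique[where s = "n + (d - 1)"])
      show "a 0 \<noteq> 0" using unit by auto
      show "real_of_int (y (n + (d - 1) + k)) = Y (n + (d - 1) + k)" for k by (simp only: y(2) Yx)
    qed (use recy \<open>recurrent Y\<close> in auto)
    have "\<bar>y k\<bar> \<le> \<lceil>M\<rceil>" if k: "k < d" for k
    proof -
      have "\<bar>H\<bar> \<le> (\<Sum>i<n. of_int B * \<beta> ^ i)"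
        unfolding H_def
      proof (intro order_trans[OF sum_abs] sum_mono)
        fix i
        have "real_of_int \<bar>g i\<bar> \<le> of_int B" using g[of i] by (simp only: of_int_le_iff)
        then show "\<bar>of_int (g i) * \<beta> ^ i\<bar> \<le> of_int B * \<beta> ^ i"
          using beta by (simp add: abs_mult mult_right_mono)
      qed
      also have "\<dots> = of_int B * ((\<beta> ^ n - 1) / (\<beta> - 1))"
        using beta by (simp add: sum_distrib_left[symmetric] geometric_sum)
      also have "\<dots> \<le> of_int B * (\<beta> ^ n / (\<beta> - 1))"
        using beta \<open>B \<ge> 0\<close> by (intro mult_left_mono divide_right_mono) auto
      finally have "\<bar>H\<bar> / \<beta> ^ n \<le> of_int B / (\<beta> - 1)"
        using beta by (simp add: pos_divide_le_eq)
      then have S: "\<bar>H / \<beta> ^ n\<bar> \<le> of_int B / (\<beta> - 1)" using beta by (simp add: abs_divide)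
      have "\<bar>c * (H / \<beta> ^ n) * \<beta> ^ k\<bar> \<le> \<bar>c\<bar> * (of_int B / (\<beta> - 1)) * \<beta> ^ d"
        unfolding abs_mult using beta k S \<open>B \<ge> 0\<close>
        by (intro mult_mono mult_left_mono) (auto intro!: power_increasing)
      moreover have "\<bar>T k\<bar> \<le> of_int B * C / (1 - \<gamma>)"
        unfolding T_def using g transient_shift_le by (rule bounded_times_decay)
      moreover have "Y k = c * (H / \<beta> ^ n) * \<beta> ^ k - T k" by (simp add: Y_def)
      moreover have "M = \<bar>c\<bar> * (of_int B / (\<beta> - 1)) * \<beta> ^ d + of_int B * C / (1 - \<gamma>)"
        by (simp add: M_def)
      ultimately have "\<bar>Y k\<bar> \<le> M" by linarith
      then have "of_int \<bar>y k\<bar> \<le> M" using yY[of k] by simp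
      then show ?thesis by (meson le_of_int_ceiling of_int_le_iff order_trans)
    qed
    then obtain h where h: "\<forall>i. \<bar>h i\<bar> \<le> F" "\<And>k. y k = (\<Sum>i<d. h i * w (i + k))"
      using F[OF _ y(1)] by blast
    have "(\<Sum>i<n. g i * U i) = y (n + (d - 1) + 0)" unfolding y(2) x_def U_eq by simp
    also have "\<dots> = (\<Sum>i<d. h i * U (n + i))"
      unfolding h(2) U_eq by (intro sum.cong) (auto simp: ac_simps)
    finally show ?thesis using h(1) by blast
  qed
  then show ?thesis using that by blast
qed

text \<open>
First remove the integers \<open>\<phi> k g\<close> by subtracting a sequence \<open>h0\<close> with \<open>d\<close> digits and value 0. Then the
values of long prefixes are unchanged, and they have bounded expansions of large order.
\<close>
lemma unimodular_null_seqs: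
  assumes unit: "\<bar>a 0\<bar> = 1" and pz: "preserves_zeros U"
    and gc: "g \<in> carrier bounded_seq_group" and ints: "\<And>k. 1 \<le> k \<Longrightarrow> k < d \<Longrightarrow> \<phi> k g \<in> \<int>"
  shows "g \<in> null_seqs U"
proof -
  have \<phi>0: "\<phi> 0 h = 0" for h by (simp add: \<phi>_def defect_def)
  have "\<forall>k. \<exists>m. k < d \<longrightarrow> \<phi> k g = of_int m"
    using ints \<phi>0 by (metis Ints_cases less_one not_le of_int_0)
  then obtain m where m: "\<And>k. k < d \<Longrightarrow> \<phi> k g = of_int (m k)" by metis
  have m0: "m 0 = 0" using m[of 0] d_pos \<phi>0[of g] by simp
  obtain h where h: "\<And>k. k < d \<Longrightarrow> - m k = (\<Sum>i<d. h i * U (i + k))"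
    using unimodular_combination[OF unit, of "\<lambda>k. - m k"] by blast
  define h0 where "h0 i = (if i < d then h i else 0)" for i
  have h0c: "h0 \<in> carrier bounded_seq_group"
    unfolding carrier_bounded_seq_group mem_Collect_eq
  proof (rule bounded_range_intI)
    fix i show "\<bar>h0 i\<bar> \<le> (\<Sum>i<d. \<bar>h i\<bar>)"
      by (auto simp: h0_def sum_nonneg intro: member_le_sum)
  qed
  have sum: "(\<Sum>i<n. h0 i * U (i + k)) = - m k" if "k < d" "n \<ge> d" for k n
  proof -
    have "(\<Sum>i<n. h0 i * U (i + k)) = (\<Sum>i<d. h0 i * U (i + k))"
      using that by (intro sum.mono_neutral_right) (auto simp: h0_def)
    also have "\<dots> = - m k" unfolding h[OF that(1)] by (intro sum.cong) (auto simp: h0_def)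
    finally show ?thesis .
  qed
  have "seq_value U h0 = (\<Sum>i<d. h0 i * U i)"
    by (rule seq_value_eq_sum) (auto simp: h0_def)
  then have v0: "seq_value U h0 = 0" using sum[of 0 d] d_pos m0 by simp
  define g' where "g' i = g i - h0 i" for i
  have g'0: "\<phi> k g' = 0" if "k < d" for k
  proof -
    have "\<phi> k h0 = of_int (seq_value U h0) * \<beta> ^ k - of_int (\<Sum>i<d. h0 i * U (i + k))"
      by (rule \<phi>_finite) (auto simp: h0_def)
    then have "\<phi> k h0 = of_int (m k)" using sum[OF that, of d] v0 by simp
    then show ?thesis unfolding g'_def using \<phi>_diff[OF gc h0c, of k] m[OF that] by simp
  qed
  obtain A where A: "\<And>i. \<bar>g i\<bar> \<le> A"
    using gc by (auto simp: carrier_bounded_seq_group elim!: bounded_range_intE)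
  obtain B where B: "\<And>i. \<bar>h0 i\<bar> \<le> B"
    using h0c by (auto simp: carrier_bounded_seq_group elim!: bounded_range_intE)
  have "\<bar>g' i\<bar> \<le> A + B" for i unfolding g'_def using A[of i] B[of i] by linarith
  then obtain F where F: "\<And>n. \<exists>h. (\<forall>i. \<bar>h i\<bar> \<le> F) \<and> (\<Sum>i<n. g' i * U i) = (\<Sum>i<d. h i * U (n + i))"
    using unimodular_tail_digits[OF unit _ g'0] by metis
  obtain K where K: "\<And>g. g \<in> finite_seqs \<Longrightarrow> (\<forall>n. \<bar>g n\<bar> \<le> int (nat F)) \<Longrightarrow>
      seq_ord g \<le> nu_seq U g + enat K"
    using pz unfolding preserves_zeros_def by blast
  have nu: "enat n \<le> nu_seq U (seq_prefix n g) + enat K" if "n \<ge> d" for n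
  proof -
    obtain e where e: "\<And>i. \<bar>e i\<bar> \<le> F" "(\<Sum>i<n. g' i * U i) = (\<Sum>i<d. e i * U (n + i))"
      using F by blast
    define f where "f i = (if n \<le> i \<and> i < n + d then e (i - n) else 0)" for i
    have "f \<in> finite_seqs" unfolding finite_seqs_def mem_Collect_eq
      by (rule finite_subset[of _ "{n..<n + d}"]) (auto simp: f_def)
    moreover have "\<bar>f i\<bar> \<le> int (nat F)" for i
    proof -
      have "0 \<le> F" using e(1)[of 0] by linarith
      then show ?thesis using e(1)[of "i - n"] by (simp add: f_def)
    qed
    ultimately have "seq_ord f \<le> nu_seq U f + enat K" by (intro K) auto
    moreover have "enat n \<le> seq_ord f" by (auto simp: enat_le_seq_ord_iff f_def)
    ultimately have le: "enat n \<le> nu_seq U f + enat K" by order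
    have "seq_value U f = (\<Sum>i\<in>{n..<n + d}. f i * U i)"
      by (rule seq_value_eq_sum) (auto simp: f_def)
    also have "\<dots> = (\<Sum>i<d. f (n + i) * U (n + i))"
      using sum.shift_bounds_nat_ivl[of "\<lambda>i. f i * U i" 0 n d] by (simp add: lessThan_atLeast0 add.commute)
    also have "\<dots> = (\<Sum>i<d. e i * U (n + i))" by (intro sum.cong) (auto simp: f_def)
    also have "\<dots> = (\<Sum>i<n. g i * U i) - (\<Sum>i<n. h0 i * U i)"
      unfolding e(2)[symmetric] by (simp add: g'_def left_diff_distrib sum_subtractf)
    also have "\<dots> = seq_value U (seq_prefix n g)"
      using sum[of 0 n] that d_pos m0 by (simp add: seq_value_seq_prefix)
    finally show ?thesis using le by (simp add: nu_seq_def)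
  qed
  have "\<forall>\<^sub>F n in sequentially. enat k \<le> nu_seq U (seq_prefix n g)" for k
    unfolding eventually_sequentially
  proof (intro exI allI impI)
    fix n assume n: "d + k + K \<le> n"
    then show "enat k \<le> nu_seq U (seq_prefix n g)"
      using nu[of n] by (cases "nu_seq U (seq_prefix n g)") auto
  qed
  then show ?thesis using gc by (simp add: null_seqs_def tendsto_enat_infinity_iff)
qed

section \<open>The map to the torus\<close>

text \<open>
This is Kronecker's theorem for \<open>\<beta>, \<dots>, \<beta>\<^bsup>d-1\<^esup>\<close> and 1.
\<close>
lemma multiples_of_powers_dense:
  assumes "\<epsilon> > 0"
  obtains N :: int and z :: "nat \<Rightarrow> int"
    where "\<And>i. i < d - 1 \<Longrightarrow> \<bar>of_int N * \<beta> ^ Suc i - of_int (z i) - x i\<bar> < \<epsilon>"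
proof -
  \<comment> \<open>The form of Kronecker's theorem used here expects 1 as the last number.\<close>
  define \<theta> where "\<theta> i = (if i < d - 1 then \<beta> ^ Suc i else 1)" for i
  have image: "\<theta> ` {..d - 1} = (\<lambda>i. \<beta> ^ i) ` {..<d}"
  proof
    show "\<theta> ` {..d - 1} \<subseteq> (\<lambda>i. \<beta> ^ i) ` {..<d}"
    proof
      fix v assume "v \<in> \<theta> ` {..d - 1}"
      then obtain i where i: "v = \<theta> i" by blast
      show "v \<in> (\<lambda>i. \<beta> ^ i) ` {..<d}"
      proof (cases "i < d - 1")
        case True
        then show ?thesis using i by (intro image_eqI[of _ _ "Suc i"]) (auto simp: \<theta>_def)
      next
        case False
        then show ?thesis using i d_pos by (intro image_eqI[of _ _ 0]) (auto simp: \<theta>_def)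
      qed
    qed
    show "(\<lambda>i. \<beta> ^ i) ` {..<d} \<subseteq> \<theta> ` {..d - 1}"
    proof
      fix v assume "v \<in> (\<lambda>i. \<beta> ^ i) ` {..<d}"
      then obtain i where i: "v = \<beta> ^ i" "i < d" by blast
      show "v \<in> \<theta> ` {..d - 1}"
      proof (cases i)
        case 0
        then show ?thesis using i by (intro image_eqI[of _ _ "d - 1"]) (auto simp: \<theta>_def)
      next
        case (Suc j)
        then show ?thesis using i by (intro image_eqI[of _ _ j]) (auto simp: \<theta>_def)
      qed
    qed
  qed
  have pow_inj: "\<beta> ^ i = \<beta> ^ j \<longleftrightarrow> i = j" for i j
    using beta by (simp add: power_inject_exp)
  have inj: "inj_on \<theta> {..d - 1}"
  proof (rule inj_onI)
    fix i j assume "i \<in> {..d - 1}" "j \<in> {..d - 1}" "\<theta> i = \<theta> j"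
    then show "i = j"
      using pow_inj[of "Suc i" "Suc j"] pow_inj[of "Suc i" 0] pow_inj[of 0 "Suc j"]
      by (auto simp: \<theta>_def split: if_splits)
  qed
  interpret Modules.module "\<lambda>r x. real_of_int r * x"
    by (simp add: Modules.module.intro distrib_left distrib_right)
  have "independent (\<theta> ` {..d - 1})"
    unfolding independent_explicit_module image
  proof (intro allI impI)
    fix t and u :: "real \<Rightarrow> int" and v
    assume t: "finite t" "t \<subseteq> (\<lambda>i. \<beta> ^ i) ` {..<d}" and sum: "(\<Sum>v\<in>t. of_int (u v) * v) = 0" and v: "v \<in> t"
    define q where "q i = (if \<beta> ^ i \<in> t then u (\<beta> ^ i) else 0)" for i
    have "t = (\<lambda>i. \<beta> ^ i) ` {i \<in> {..<d}. \<beta> ^ i \<in> t}" using t by blast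
    then have "(\<Sum>v\<in>t. of_int (u v) * v) = (\<Sum>v\<in>(\<lambda>i. \<beta> ^ i) ` {i \<in> {..<d}. \<beta> ^ i \<in> t}. of_int (u v) * v)"
      by (rule arg_cong)
    also have "\<dots> = (\<Sum>i\<in>{i \<in> {..<d}. \<beta> ^ i \<in> t}. of_int (u (\<beta> ^ i)) * \<beta> ^ i)"
      by (subst sum.reindex) (auto simp: inj_on_def pow_inj)
    also have "\<dots> = (\<Sum>i<d. of_int (q i) * \<beta> ^ i)"
      by (intro sum.mono_neutral_cong_left) (auto simp: q_def)
    finally have q0: "(\<Sum>i<d. of_int (q i) * \<beta> ^ i) = 0" using sum by simp
    have q: "q i = 0" if "i < d" for i using indep[of q i, OF q0 that] .
    obtain i where "i < d" "v = \<beta> ^ i" using v t by blast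
    then show "u v = 0" using q[of i] v by (simp add: q_def)
  qed
  moreover have "\<theta> (d - 1) = 1" by (simp add: \<theta>_def)
  ultimately obtain N z where "\<And>i. i < d - 1 \<Longrightarrow> \<bar>of_int N * \<theta> i - of_int (z i) - x i\<bar> < \<epsilon>"
    using Kronecker_thm_2[of \<theta> "d - 1" \<epsilon> x] inj \<open>\<epsilon> > 0\<close> by metis
  then have "\<bar>of_int N * \<beta> ^ Suc i - of_int (z i) - x i\<bar> < \<epsilon>" if "i < d - 1" for i
    using that by (metis \<theta>_def)
  then show ?thesis by (rule that)
qed

definition \<phi>_vec :: "(nat \<Rightarrow> int) \<Rightarrow> nat \<Rightarrow> real" where
  "\<phi>_vec g = (\<lambda>i\<in>{..<d - 1}. \<phi> (Suc i) g)"

lemma \<phi>_vec_extensional: "\<phi>_vec g \<in> extensional {..<d - 1}"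
  by (simp add: \<phi>_vec_def)

abbreviation seqs :: "(nat \<Rightarrow> int) topology" where
  "seqs \<equiv> Metric_space.mtopology (carrier bounded_seq_group) (seq_dist \<gamma>)"

lemma continuous_\<phi>_vec: "continuous_map seqs (real_space (d - 1)) \<phi>_vec"
proof -
  interpret Metric_space "carrier bounded_seq_group" "seq_dist \<gamma>"
    by (rule Metric_space_seq_dist[OF gamma])
  show ?thesis
    unfolding continuous_map_componentwise
  proof (intro conjI ballI)
    fix k assume k: "k \<in> {..<d - 1}"
    define D where "D = (\<beta> ^ Suc k + 1) * C"
    have "D \<ge> 0" using beta C_nonneg by (simp add: D_def)
    have "continuous_map mtopology euclideanreal (\<phi> (Suc k))"
      unfolding continuous_map_from_metric
    proof (intro conjI ballI allI impI)
      fix g V assume g: "g \<in> carrier bounded_seq_group" and "openin euclideanreal V \<and> \<phi> (Suc k) g \<in> V"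
      then have "open V" "\<phi> (Suc k) g \<in> V" by auto
      then obtain e where e: "e > 0" "\<And>y. dist y (\<phi> (Suc k) g) < e \<Longrightarrow> y \<in> V"
        unfolding open_dist by blast
      show "\<exists>\<rho>>0. \<forall>h. h \<in> carrier bounded_seq_group \<and> seq_dist \<gamma> g h < \<rho> \<longrightarrow> \<phi> (Suc k) h \<in> V"
      proof (intro exI conjI allI impI)
        show "e / (D + 1) > 0" using e \<open>D \<ge> 0\<close> by simp
        fix h assume h: "h \<in> carrier bounded_seq_group \<and> seq_dist \<gamma> g h < e / (D + 1)"
        have "\<bar>\<phi> (Suc k) g - \<phi> (Suc k) h\<bar> \<le> D * seq_dist \<gamma> g h"
          unfolding D_def using g h by (intro \<phi>_Lipschitz) auto
        also have "\<dots> \<le> (D + 1) * seq_dist \<gamma> g h"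
          by (intro mult_right_mono) auto
        also have "\<dots> < e" using h \<open>D \<ge> 0\<close> by (simp add: pos_less_divide_eq mult.commute)
        finally show "\<phi> (Suc k) h \<in> V" by (intro e) (simp add: dist_real_def abs_minus_commute)
      qed
    qed auto
    then show "continuous_map seqs euclideanreal (\<lambda>g. \<phi>_vec g k)"
      using k by (simp add: \<phi>_vec_def)
  qed (use \<phi>_vec_extensional in auto)
qed

text \<open>
Modulo integers, \<open>\<phi>_vec\<close> maps an expansion of \<open>N\<close> to \<open>N (\<beta>, \<dots>, \<beta>\<^bsup>d-1\<^esup>)\<close>, and all integers have
expansions with digits below a common bound.
\<close>
lemma \<phi>_vec_dense:
  obtains B :: int where "\<And>x \<epsilon>. \<epsilon> > 0 \<Longrightarrow>
    \<exists>g\<in>{g. \<forall>i. \<bar>g i\<bar> \<le> B}. \<exists>z::nat \<Rightarrow> int. \<forall>i<d - 1. \<bar>\<phi>_vec g i - of_int (z i) - x i\<bar> < \<epsilon>"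
proof -
  obtain B where B: "\<And>N. \<exists>e\<in>finite_seqs. seq_value U e = N \<and> seq_ord e = nu U N \<and> (\<forall>i. \<bar>e i\<bar> \<le> B)"
    using bounded_expansions by metis
  have "\<exists>g\<in>{g. \<forall>i. \<bar>g i\<bar> \<le> B}. \<exists>z::nat \<Rightarrow> int. \<forall>i<d - 1. \<bar>\<phi>_vec g i - of_int (z i) - x i\<bar> < \<epsilon>"
    if "\<epsilon> > 0" for x \<epsilon>
  proof -
    obtain N and z :: "nat \<Rightarrow> int" where z: "\<And>i. i < d - 1 \<Longrightarrow> \<bar>of_int N * \<beta> ^ Suc i - of_int (z i) - x i\<bar> < \<epsilon>"
      using multiples_of_powers_dense[OF \<open>\<epsilon> > 0\<close>] by metis
    obtain e where e: "e \<in> finite_seqs" "seq_value U e = N" "\<And>i. \<bar>e i\<bar> \<le> B" using B by metis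
    have "\<forall>i. \<exists>y::int. \<phi> (Suc i) e = of_int N * \<beta> ^ Suc i - of_int y"
      using \<phi>_cong_seq_value[OF e(1)] unfolding e(2) by metis
    then obtain y :: "nat \<Rightarrow> int" where y: "\<And>i. \<phi> (Suc i) e = of_int N * \<beta> ^ Suc i - of_int (y i)" by metis
    have "\<bar>\<phi>_vec e i - of_int (z i - y i) - x i\<bar> < \<epsilon>" if "i < d - 1" for i
      using z[OF that] that by (simp add: \<phi>_vec_def y)
    then show ?thesis using e(3) by (intro bexI[of _ e] exI[of _ "\<lambda>i. z i - y i"]) auto
  qed
  then show ?thesis using that by blast
qed

definition \<psi> :: "(nat \<Rightarrow> int) \<Rightarrow> (nat \<Rightarrow> real) set" where
  "\<psi> g = integer_lattice (d - 1) #>\<^bsub>real_space_group (d - 1)\<^esub> \<phi>_vec g"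

lemma \<psi>_eq_iff:
  assumes "g \<in> carrier bounded_seq_group" "h \<in> carrier bounded_seq_group"
  shows "\<psi> g = \<psi> h \<longleftrightarrow> (\<forall>i<d - 1. \<phi> (Suc i) (\<lambda>j. g j - h j) \<in> \<int>)"
  unfolding \<psi>_def
  using integer_lattice_coset_eq_iff[OF \<phi>_vec_extensional \<phi>_vec_extensional, of g h] assms
  by (simp add: \<phi>_vec_def \<phi>_diff)

lemma \<psi>_hom: "\<psi> \<in> hom bounded_seq_group (torus_group (d - 1))"
proof -
  interpret N: normal "integer_lattice (d - 1)" "real_space_group (d - 1)" by (rule integer_lattice_normal)
  have "\<phi>_vec \<in> hom bounded_seq_group (real_space_group (d - 1))"
  proof (rule homI)
    fix g h assume "g \<in> carrier bounded_seq_group" "h \<in> carrier bounded_seq_group"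
    then show "\<phi>_vec (g \<otimes>\<^bsub>bounded_seq_group\<^esub> h) = \<phi>_vec g \<otimes>\<^bsub>real_space_group (d - 1)\<^esub> \<phi>_vec h"
      using \<phi>_add by (simp add: \<phi>_vec_def mult_real_space_group fun_eq_iff restrict_def) (simp add: bounded_seq_group_def)
  qed (simp only: carrier_real_space_group \<phi>_vec_extensional)
  from hom_compose[OF this N.r_coset_hom_Mod]
  show ?thesis unfolding torus_group_def \<psi>_def[abs_def] o_def .
qed

lemma \<psi>_quotient_map:
  "quotient_map seqs (torus_topology (d - 1)) \<psi>"
proof -
  obtain B where B: "\<And>x \<epsilon>. \<epsilon> > 0 \<Longrightarrow>
    \<exists>g\<in>{g. \<forall>i. \<bar>g i\<bar> \<le> B}. \<exists>z::nat \<Rightarrow> int. \<forall>i<d - 1. \<bar>\<phi>_vec g i - of_int (z i) - x i\<bar> < \<epsilon>"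
    using \<phi>_vec_dense by blast
  have K: "compactin seqs {g. \<forall>i. \<bar>g i\<bar> \<le> B}" by (rule compactin_bounded_digits[OF gamma])
  show ?thesis
    unfolding \<psi>_def
    by (rule quotient_map_onto_torus[OF continuous_\<phi>_vec K compact_onto_torus[OF continuous_\<phi>_vec K B]])
qed

text \<open>
The map on cosets exists because \<open>\<psi>\<close> is constant on them, and everything topological about it follows
from \<open>\<psi>\<close> being a quotient map.
\<close>
lemma torus_epimorphism:
  assumes pz: "preserves_zeros U"
  shows "\<exists>\<Phi>. \<Phi> \<in> epi (Z_group U) (torus_group (d - 1)) \<and>
             continuous_map (quotient_topology seqs (\<lambda>g. null_seqs U #>\<^bsub>bounded_seq_group\<^esub> g))
               (torus_topology (d - 1)) \<Phi> \<and>
             (\<bar>a 0\<bar> = 1 \<longrightarrow>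
                \<Phi> \<in> iso (Z_group U) (torus_group (d - 1)) \<and>
                homeomorphic_map (quotient_topology seqs (\<lambda>g. null_seqs U #>\<^bsub>bounded_seq_group\<^esub> g))
                  (torus_topology (d - 1)) \<Phi>)"
proof -
  interpret G: comm_group bounded_seq_group by (rule comm_group_bounded_seq_group)
  interpret Metric_space "carrier bounded_seq_group" "seq_dist \<gamma>"
    by (rule Metric_space_seq_dist[OF gamma])
  have sub: "subgroup (null_seqs U) bounded_seq_group" by (rule subgroup_null_seqs[OF pz])
  then have norm: "null_seqs U \<lhd> bounded_seq_group" by (rule G.subgroup_imp_normal)
  interpret H: normal "null_seqs U" bounded_seq_group by (rule norm)
  define q where "q g = null_seqs U #>\<^bsub>bounded_seq_group\<^esub> g" for g
  have minus: "g \<otimes>\<^bsub>bounded_seq_group\<^esub> inv\<^bsub>bounded_seq_group\<^esub> h = (\<lambda>j. g j - h j)"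
    if "h \<in> carrier bounded_seq_group" for g h
    unfolding inv_bounded_seq_group[OF that] by (simp add: bounded_seq_group_def)
  have q_eq_iff: "q g = q h \<longleftrightarrow> (\<lambda>j. g j - h j) \<in> null_seqs U"
    if gh: "g \<in> carrier bounded_seq_group" "h \<in> carrier bounded_seq_group" for g h
  proof
    assume "q g = q h"
    then have "g \<in> q h" using G.rcos_self[OF gh(1) sub] by (simp add: q_def)
    then show "(\<lambda>j. g j - h j) \<in> null_seqs U"
      using H.rcos_module_imp[OF G.is_group gh(2)] minus[OF gh(2)] by (simp add: q_def)
  next
    assume "(\<lambda>j. g j - h j) \<in> null_seqs U"
    then have "g \<in> q h"
      using H.rcos_module_rev[OF G.is_group gh(2,1)] minus[OF gh(2)] by (simp add: q_def)
    then show "q g = q h" unfolding q_def using G.repr_independence[OF _ gh(2) sub] by simp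
  qed
  have "\<psi> g = \<psi> h" if "g \<in> carrier bounded_seq_group" "h \<in> carrier bounded_seq_group" "q g = q h" for g h
    using that \<phi>_null_seqs by (simp add: q_eq_iff \<psi>_eq_iff)
  then obtain \<Phi> where \<Phi>: "\<Phi> \<in> hom (bounded_seq_group Mod null_seqs U) (torus_group (d - 1))"
    "\<And>g. g \<in> carrier bounded_seq_group \<Longrightarrow> \<Phi> (q g) = \<psi> g"
    using FactGroup_universal[OF \<psi>_hom norm] unfolding q_def by metis
  have carrier_Z: "carrier (Z_group U) = q ` carrier bounded_seq_group"
    by (auto simp: Z_group_def FactGroup_def RCOSETS_def q_def)
  have carrier_T: "carrier (torus_group (d - 1)) = topspace (torus_topology (d - 1))"
    unfolding torus_topology_def topspace_quotient_topology topspace_real_space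
    by (auto simp: torus_group_def FactGroup_def RCOSETS_def carrier_real_space_group)
  define Z where "Z = quotient_topology seqs q"
  have quot_q: "quotient_map seqs Z q" unfolding Z_def by (rule quotient_map_quotient_topology)
  have top_Z: "topspace Z = q ` carrier bounded_seq_group"
    by (simp add: Z_def topspace_quotient_topology)
  have \<Phi>q: "quotient_map seqs (torus_topology (d - 1)) (\<Phi> \<circ> q)"
    using \<psi>_quotient_map by (rule quotient_map_eq) (simp add: \<Phi>(2))
  have cont: "continuous_map Z (torus_topology (d - 1)) \<Phi>"
    by (rule continuous_compose_quotient_map[OF quot_q quotient_imp_continuous_map[OF \<Phi>q]])
  have quot: "quotient_map Z (torus_topology (d - 1)) \<Phi>"
    by (rule quotient_map_from_composition[OF quotient_imp_continuous_map[OF quot_q] cont \<Phi>q])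
  have onto: "\<Phi> ` carrier (Z_group U) = carrier (torus_group (d - 1))"
    using quotient_imp_surjective_map[OF quot] by (simp only: carrier_Z carrier_T top_Z)
  have hom: "\<Phi> \<in> hom (Z_group U) (torus_group (d - 1))" using \<Phi>(1) by (simp add: Z_group_def)
  have inj: "inj_on \<Phi> (topspace Z)" if unit: "\<bar>a 0\<bar> = 1"
    unfolding top_Z
  proof (rule inj_onI, clarify)
    fix g h assume g: "g \<in> carrier bounded_seq_group" and h: "h \<in> carrier bounded_seq_group"
      and eq: "\<Phi> (q g) = \<Phi> (q h)"
    define f where "f = (\<lambda>j. g j - h j)"
    have fc: "f \<in> carrier bounded_seq_group"
      using G.m_closed[OF g G.inv_closed[OF h]] minus[OF h] by (simp add: f_def)
    have "\<phi> k f \<in> \<int>" if "1 \<le> k" "k < d" for k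
      using eq \<Phi>(2) g h \<psi>_eq_iff[OF g h] that by (cases k) (auto simp: f_def)
    then have "f \<in> null_seqs U" by (rule unimodular_null_seqs[OF unit pz fc])
    then show "q g = q h" using q_eq_iff[OF g h] by (simp add: f_def)
  qed
  have "\<Phi> \<in> epi (Z_group U) (torus_group (d - 1))" using hom onto by (simp add: epi_def)
  moreover have "\<Phi> \<in> iso (Z_group U) (torus_group (d - 1))" if "\<bar>a 0\<bar> = 1"
    using hom onto inj[OF that] by (simp add: iso_def bij_betw_def carrier_Z top_Z)
  moreover have "homeomorphic_map Z (torus_topology (d - 1)) \<Phi>" if "\<bar>a 0\<bar> = 1"
    using quot inj[OF that] by (simp add: homeomorphic_map_def)
  ultimately show ?thesis using cont unfolding Z_def q_def by blast
qed

end

theorem theorem1: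
  fixes \<beta> :: real and v :: "int \<Rightarrow> int" and U :: "nat \<Rightarrow> int" and d :: nat
  assumes "pisot_numeration \<beta> v U"
    and "d = pisot_degree \<beta>"
    and "standard_initial_conditions \<beta> v"
    and "preserves_zeros U"
  shows "\<exists>\<Phi>. \<Phi> \<in> epi (Z_group U) (torus_group (d - 1)) \<and>
             continuous_map (Z_topology \<beta> U) (torus_topology (d - 1)) \<Phi> \<and>
             (unimodular \<beta> \<longrightarrow>
                \<Phi> \<in> iso (Z_group U) (torus_group (d - 1)) \<and>
                homeomorphic_map (Z_topology \<beta> U) (torus_topology (d - 1)) \<Phi>)"
proof -
  have pisot: "pisot_number \<beta>" and U_v: "\<And>n. U n = v (int n)" and U_pos: "\<And>n. U n > 0" and v0: "v 0 = 1"
    and v_rec: "\<And>n. n \<ge> 1 \<Longrightarrow> v n = (\<Sum>i<d. - coeff (min_poly \<beta>) i * v (n - int d + int i))"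
    using assms(1,2) by (auto simp: pisot_numeration_def)
  have b: "algebraic_int \<beta>" "1 < \<beta>" using pisot by (auto simp: pisot_number_def)
  note mp = is_min_poly_min_poly[OF b(1)]
  have d: "d = degree (min_poly \<beta>)" using assms(2) by (simp add: pisot_degree_def)
  have d_pos: "d > 0" unfolding d by (rule degree_min_poly_pos[OF mp])
  define w where "w m = v (int m - int (d - 1))" for m
  define a where "a i = - coeff (min_poly \<beta>) i" for i
  have w_zero: "w m = 0" if "m < d - 1" for m
  proof -
    have "v (- int (d - 1 - m)) = 0"
      using assms(2,3) that by (intro assms(3)[unfolded standard_initial_conditions_def, rule_format]) auto
    moreover have "int m - int (d - 1) = - int (d - 1 - m)" using that by (simp add: of_nat_diff)
    ultimately show ?thesis by (simp only: w_def)
  qed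
  have w_one: "w (d - 1) = 1" by (simp add: w_def v0)
  have w_rec: "w (m + d) = (\<Sum>i<d. a i * w (m + i))" for m
  proof -
    have "w (m + d) = v (int m + 1)" using d_pos by (simp add: w_def of_nat_diff)
    also have "\<dots> = (\<Sum>i<d. a i * v (int m + 1 - int d + int i))" by (subst v_rec) (simp_all add: a_def)
    also have "\<dots> = (\<Sum>i<d. a i * w (m + i))"
      using d_pos by (intro sum.cong) (auto simp: w_def of_nat_diff algebra_simps)
    finally show ?thesis .
  qed
  obtain c C where asym: "\<And>m. \<bar>of_int (w m) - c * \<beta> ^ m\<bar> \<le> C * conj_radius \<beta> ^ m"
    using impulse_response_asymptotics[OF pisot assms(2), of w] w_zero w_one w_rec unfolding a_def by blast
  interpret pisot_recurrence d a w U \<beta> "conj_radius \<beta>" c C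
  proof
    show "U n = w (n + (d - 1))" for n by (simp add: w_def U_v)
    show "\<beta> ^ d = (\<Sum>i<d. of_int (a i) * \<beta> ^ i)"
      unfolding d a_def by (rule is_min_poly_root_powers[OF mp])
    show "q i = 0" if "(\<Sum>i<d. of_int (q i) * \<beta> ^ i) = 0" "i < d" for q :: "nat \<Rightarrow> int" and i
      using powers_independent[OF mp] that unfolding d by blast
  qed (use d_pos w_zero w_one w_rec U_pos b conj_radius_bounds[OF pisot] asym in auto)
  from torus_epimorphism[OF assms(4)]
  show ?thesis
    by (simp add: Z_topology_def seq_topology_def unimodular_def a_def)
qed

end
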